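(* Let $\mathcal{D}\subset \mathbb{C}\cup\{\infty\}=\partial H^3$ be an arbitrary open disk in the ideal boundary of hyperbolic $3$-space. Then there exists a weakly complete flat front $f=\mathcal{L}\mathcal{L}^*\colon \mathbb{D}_1\to H^3$ (with $\mathcal{L}\colon\mathbb{D}_1\to \mathrm{SL}(2,\mathbb{C})$ a holomorphic Legendrian immersion) whose pair of hyperbolic Gauss maps $G_+,G_-$ both satisfy $G_\pm(\mathbb{D}_1)\subset \mathcal{D}$.
   Context: $\mathbb{D}_1=\{z\in\mathbb{C}: |z|<1\}$. Hyperbolic $3$-space is realized as $H^3=\mathrm{SL}(2,\mathbb{C})/\mathrm{SU}(2)=\{aa^*: a\in \mathrm{SL}(2,\mathbb{C})\}$, $a^*={}^t\bar a$, with ideal boundary identified with $\mathbb{C}\cup\{\infty\}$ via the Poincaré upper half-space model. A holomorphic immersion $\mathcal{L}\colon \mathbb{D}_1\to\mathrm{SL}(2,\mathbb{C})$ is called Legendrian if it is Legendrian for the complex contact form $x_{11}dx_{22}-x_{21}dx_{12}$; equivalently $\mathcal{L}^{-1}d\mathcal{L}=\begin{pmatrix}0&\theta\\ \omega&0\end{pmatrix}$ for holomorphic $1$-forms $\omega,\theta$ on $\mathbb{D}_1$. The map $f=\mathcal{L}\mathcal{L}^*\colon\mathbb{D}_1\to H^3$ is then a flat front (flat surface with admissible singularities), and $\mathcal{L}$ is its holomorphic lift. The front $f$ is weakly complete if the metric $ds^2_{\mathcal L}=|\omega|^2+|\theta|^2$ is a complete Riemannian metric on $\mathbb{D}_1$.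 Writing $\mathcal{L}=\begin{pmatrix}A&B\\C&D\end{pmatrix}$, the hyperbolic Gauss maps of $f$ are $G_+=A/C$ and $G_-=B/D$ (meromorphic functions into $\mathbb{C}\cup\{\infty\}$). *)

theory Defs
  imports "HOL-Analysis.Analysis"
begin

text \<open>The Riemann sphere / ideal boundary of H^3: None = infinity, Some z = z.\<close>
type_synonym csphere = "complex option"

definition unit_disk :: "complex set" where
  "unit_disk = ball 0 1"

definition open_sphere_disk :: "csphere set \<Rightarrow> bool" where
  "open_sphere_disk S \<longleftrightarrow>
     (\<exists>c r. r > 0 \<and> S = Some ` ball c r) \<or>
     (\<exists>c r. r > 0 \<and> S = insert None (Some ` {z. dist z c > r})) \<or>
     (\<exists>u a. u \<noteq> 0 \<and> S = Some ` {z. Re (cnj u * z) > a})"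

text \<open>Quotient p/q as a point of the Riemann sphere (used only where p, q do not both vanish).\<close>
definition sphere_quot :: "complex \<Rightarrow> complex \<Rightarrow> csphere" where
  "sphere_quot p q = (if q = 0 then None else Some (p / q))"

text \<open>L = (A B; C D) : unit disk -> SL(2,C) is a holomorphic Legendrian immersion.
  Legendrian: pullback of x11 dx22 - x21 dx12 vanishes, i.e. A D' - C B' = 0.
  Immersion: L'(z) \<noteq> 0.\<close>
definition holomorphic_legendrian_immersion ::
  "(complex \<Rightarrow> complex) \<Rightarrow> (complex \<Rightarrow> complex) \<Rightarrow> (complex \<Rightarrow> complex) \<Rightarrow> (complex \<Rightarrow> complex) \<Rightarrow> bool" where
  "holomorphic_legendrian_immersion A B C D \<longleftrightarrow>
     A holomorphic_on unit_disk \<and> B holomorphic_on unit_disk \<and>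
     C holomorphic_on unit_disk \<and> D holomorphic_on unit_disk \<and>
     (\<forall>z\<in>unit_disk. A z * D z - B z * C z = 1) \<and>
     (\<forall>z\<in>unit_disk. A z * deriv D z - C z * deriv B z = 0) \<and>
     (\<forall>z\<in>unit_disk. (deriv A z, deriv B z, deriv C z, deriv D z) \<noteq> (0, 0, 0, 0))"

text \<open>L^{-1} dL = (0 theta; omega 0), with omega = omega_coef dz, theta = theta_coef dz.\<close>
definition omega_coef :: "(complex \<Rightarrow> complex) \<Rightarrow> (complex \<Rightarrow> complex) \<Rightarrow> complex \<Rightarrow> complex" where
  "omega_coef A C z = A z * deriv C z - C z * deriv A z"

definition theta_coef :: "(complex \<Rightarrow> complex) \<Rightarrow> (complex \<Rightarrow> complex) \<Rightarrow> complex \<Rightarrow> complex" where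
  "theta_coef B D z = D z * deriv B z - B z * deriv D z"

definition complete_conformal_metric :: "(complex \<Rightarrow> real) \<Rightarrow> bool" where
  "complete_conformal_metric rho \<longleftrightarrow>
     (\<forall>z\<in>unit_disk. rho z > 0) \<and>
     (\<forall>\<gamma> \<gamma>'. (\<forall>t\<in>{0..<1}. \<gamma> t \<in> unit_disk) \<and>
         (\<forall>t\<in>{0..<1}. (\<gamma> has_vector_derivative \<gamma>' t) (at t within {0..<1})) \<and>
         continuous_on {0..<1} \<gamma>' \<and>
         ((\<lambda>t. norm (\<gamma> t)) \<longlongrightarrow> 1) (at_left (1::real))
       \<longrightarrow> (\<integral>\<^sup>+ t. ennreal (indicator {0..<1} t * (sqrt (rho (\<gamma> t)) * norm (\<gamma>' t))) \<partial>lborel) = \<infinity>)"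

definition weakly_complete ::
  "(complex \<Rightarrow> complex) \<Rightarrow> (complex \<Rightarrow> complex) \<Rightarrow> (complex \<Rightarrow> complex) \<Rightarrow> (complex \<Rightarrow> complex) \<Rightarrow> bool" where
  "weakly_complete A B C D \<longleftrightarrow>
     complete_conformal_metric
       (\<lambda>z. (cmod (omega_coef A C z))\<^sup>2 + (cmod (theta_coef B D z))\<^sup>2)"

definition gauss_plus :: "(complex \<Rightarrow> complex) \<Rightarrow> (complex \<Rightarrow> complex) \<Rightarrow> complex \<Rightarrow> csphere" where
  "gauss_plus A C z = sphere_quot (A z) (C z)"

definition gauss_minus :: "(complex \<Rightarrow> complex) \<Rightarrow> (complex \<Rightarrow> complex) \<Rightarrow> complex \<Rightarrow> csphere" where
  "gauss_minus B D z = sphere_quot (B z) (D z)"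

end

theory Submission
  imports Defs "HOL-Complex_Analysis.Complex_Analysis" "HOL-Real_Asymp.Real_Asymp"
begin

text \<open>
  A front is determined by its Gauss maps \<open>G\<close>, \<open>H\<close> through \<open>\<Delta> = exp (\<integral> dG / (G - H))\<close>. With
  \<open>G = exp (\<i> \<alpha>)\<close>, \<open>H = G (q - 1 - \<i>) / (q - 1)\<close> and \<open>\<Delta> = exp \<delta>\<close> the condition becomes the contact
  equation \<open>d\<delta> = (q - 1) d\<alpha>\<close>, and as long as \<open>Im \<alpha>\<close>, \<open>q\<close>, \<open>Re \<delta>\<close> stay small, both Gauss maps are
  bounded and \<open>|\<omega>|\<^sup>2 + |\<theta>|\<^sup>2\<close> is comparable to \<open>|d\<alpha>|\<^sup>2 + |dq|\<^sup>2\<close>.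

  In the space of \<open>(\<alpha>, q, Re \<delta>)\<close>, the set \<open>(Im \<alpha>)\<^sup>2 + |q|\<^sup>2 + (Re \<delta>)\<^sup>2 < const\<close> is a tube around a
  curve transverse to the contact planes. The boundary of such a tube is nowhere tangent to the contact
  planes, so at each of its points there is a distinguished nonzero complex contact direction tangent to
  it, depending continuously on the point. Starting from polynomials one adds \<open>a\<^sub>k z\<^bsup>m\<^esup>\<close> times this
  direction along the unit circle, with \<open>m\<close> huge compared with everything before. The tube function on
  the circle then changes only by \<open>O(a\<^sub>k\<^sup>2)\<close>, while crossing an annulus of width about \<open>1/m\<close> near the
  circle costs length at least a constant times \<open>a\<^sub>k\<close>. Taking \<open>a\<^sub>k\<close> proportional to \<open>1/k\<close> yields in the
  limit a complete curve inside the tube.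
\<close>

section \<open>The tube function and its tangent contact direction\<close>

text \<open>Squared distance to the core \<open>Im a = 0\<close>, \<open>q = 0\<close>,
  \<open>Re d = 0\<close>. \<open>Im d\<close> stays free because only moduli of exponentials of
  \<open>\<delta>\<close> have to be controlled in the end.\<close>

definition tube :: "complex \<Rightarrow> complex \<Rightarrow> complex \<Rightarrow> real" where
  "tube a q d = (Im a)\<^sup>2 + (cmod q)\<^sup>2 + (Re d)\<^sup>2"

text \<open>The step \<open>(\<lambda> cnj q, \<lambda> tube_dir a q d)\<close> in \<open>(\<alpha>, q)\<close>, together with the forced first-order step
  \<open>\<lambda> (q - 1) cnj q\<close> in \<open>\<delta>\<close>, annihilates the differential of \<open>tube\<close> for every complex \<open>\<lambda>\<close>.\<close>

definition tube_dir :: "complex \<Rightarrow> complex \<Rightarrow> complex \<Rightarrow> complex" where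
  "tube_dir a q d = \<i> * of_real (Im a) + (1 - q) * of_real (Re d)"

lemma tube_bounds:
  assumes "tube a q d \<le> 1/4"
  shows "\<bar>Im a\<bar> \<le> 1/2" "cmod q \<le> 1/2" "\<bar>Re d\<bar> \<le> 1/2"
proof -
  have "(Im a)\<^sup>2 \<le> (1/2)\<^sup>2" "(cmod q)\<^sup>2 \<le> (1/2)\<^sup>2" "(Re d)\<^sup>2 \<le> (1/2)\<^sup>2"
    using assms[unfolded tube_def] zero_le_power2[of "Im a"] zero_le_power2[of "Re d"]
      zero_le_power2[of "cmod q"] power_divide[of 1 "2::real" 2, simplified] by linarith+
  then show "\<bar>Im a\<bar> \<le> 1/2" "cmod q \<le> 1/2" "\<bar>Re d\<bar> \<le> 1/2"
    using abs_le_square_iff[of "Im a" "1/2"] abs_le_square_iff[of "cmod q" "1/2"]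
      abs_le_square_iff[of "Re d" "1/2"] by auto
qed

lemma tube_dir_upper:
  assumes "tube a q d \<le> 1/4"
  shows "cmod (tube_dir a q d) \<le> 2"
proof -
  note b = tube_bounds[OF assms]
  have "cmod (1 - q) \<le> 3/2" using norm_triangle_ineq4[of 1 q] b(2) by simp
  then have "cmod (1 - q) * \<bar>Re d\<bar> \<le> 3/2 * (1/2)" using b(3) by (intro mult_mono) auto
  then show ?thesis unfolding tube_dir_def
    using norm_triangle_ineq[of "\<i> * of_real (Im a)" "(1 - q) * of_real (Re d)"] b(1)
    by (simp add: norm_mult)
qed

text \<open>Quantitative transversality: \<open>tube_dir\<close> is \<open>Z - q * Re d\<close> with
  \<open>Z = Re d + \<i> * Im a\<close>, so for \<open>cmod q \<le> 1/2\<close> its norm is at least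
  half of \<open>cmod Z\<close>, while \<open>(cmod q)\<^sup>2 + (cmod Z)\<^sup>2\<close> is the
  tube value. Hence the step \<open>(cnj q, tube_dir a q d)\<close> cannot degenerate away from the
  core.\<close>

lemma tube_dir_lower:
  assumes "tube a q d \<le> 1/4" "1/32 \<le> tube a q d"
  shows "1/16 \<le> cmod q + cmod (tube_dir a q d)"
proof (rule ccontr)
  assume neg: "\<not> ?thesis"
  note b = tube_bounds[OF assms(1)]
  let ?Z = "Complex (Re d) (Im a)"
  have eq: "tube_dir a q d = ?Z - q * of_real (Re d)"
    unfolding tube_dir_def by (simp add: complex_eq_iff algebra_simps)
  have Z: "\<bar>Re d\<bar> \<le> cmod ?Z" using abs_Re_le_cmod[of ?Z] by simp
  have "cmod q * \<bar>Re d\<bar> \<le> 1/2 * cmod ?Z" using b Z by (intro mult_mono) auto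
  then have "cmod (tube_dir a q d) \<ge> cmod ?Z / 2"
    unfolding eq using norm_triangle_ineq2[of ?Z "q * of_real (Re d)"] by (simp add: norm_mult)
  then have "2 * cmod q + cmod ?Z \<le> 1/8" using neg norm_ge_zero[of q] by linarith
  then have "cmod q \<le> 1/8" "cmod ?Z \<le> 1/8" using norm_ge_zero[of q] norm_ge_zero[of ?Z] by linarith+
  then have "(cmod q)\<^sup>2 \<le> (1/8)\<^sup>2" "(cmod ?Z)\<^sup>2 \<le> (1/8)\<^sup>2"
    by (intro power_mono; simp)+
  moreover have "2 * cmod q + cmod ?Z < 1/8" using neg \<open>cmod (tube_dir a q d) \<ge> cmod ?Z / 2\<close> norm_ge_zero[of q] by linarith
  then have "cmod q < 1/8" using norm_ge_zero[of q] norm_ge_zero[of ?Z] by linarith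
  then have "(cmod q)\<^sup>2 < (1/8)\<^sup>2" by (intro power_strict_mono) auto
  moreover have "(cmod ?Z)\<^sup>2 = (Re d)\<^sup>2 + (Im a)\<^sup>2" by (simp add: cmod_power2)
  ultimately show False using assms(2) unfolding tube_def by (simp add: power_divide)
qed

text \<open>The linear terms cancel by the choice of \<open>tube_dir\<close>, and only terms of
  order \<open>(cmod l)\<^sup>2\<close> survive. The term \<open>l\<^sup>2 / 2 * (cnj q * w)\<close>
  is the second-order part of integrating \<open>(q - 1) d\<alpha>\<close> along the step, and
  \<open>e\<close> leaves room for lower-order errors of that integration.\<close>

lemma tube_step:
  fixes a q d l e :: complex
  assumes t: "tube a q d \<le> 1/4" and l: "cmod l \<le> 1" and e: "cmod e \<le> (cmod l)\<^sup>2"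
  defines "w \<equiv> tube_dir a q d"
  shows "\<bar>tube (a + l * cnj q) (q + l * w)
            (d + (l * (q - 1) * cnj q + l\<^sup>2 / 2 * (cnj q * w) + e)) - tube a q d\<bar> \<le> 16 * (cmod l)\<^sup>2"
proof -
  note b = tube_bounds[OF t]
  have w: "cmod w \<le> 2" using tube_dir_upper[OF t] by (simp add: w_def)
  define k where "k = l * cnj q"
  define Y where "Y = Re (l\<^sup>2 / 2 * (cnj q * w) + e)"
  define X where "X = Re (k * (q - 1)) + Y"
  \<comment> \<open>Half of the differential of \<open>tube\<close> along the step;
    \<open>tube_dir\<close> is defined to make this vanish for every \<open>l\<close>.\<close>
  have first: "Im a * Im k + Re (k * w) + Re d * Re (k * (q - 1)) = 0"
    unfolding w_def tube_dir_def by (simp add: algebra_simps)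
  have nq: "(cmod (q + l * w))\<^sup>2 = (cmod q)\<^sup>2 + 2 * Re (k * w) + (cmod (l * w))\<^sup>2"
    unfolding k_def cmod_power2 by (simp add: power2_eq_square algebra_simps)
  have Xe: "Re (l * (q - 1) * cnj q + l\<^sup>2 / 2 * (cnj q * w) + e) = X"
    unfolding X_def Y_def k_def by (simp add: algebra_simps)
  have Im_k: "Im (a + l * cnj q) = Im a + Im k" unfolding k_def by simp
  have Re_X: "Re (d + (l * (q - 1) * cnj q + l\<^sup>2 / 2 * (cnj q * w) + e)) = Re d + X"
    unfolding plus_complex.sel(1)[of d] Xe ..
  have "tube (a + l * cnj q) (q + l * w) (d + (l * (q - 1) * cnj q + l\<^sup>2 / 2 * (cnj q * w) + e)) - tube a q d
     = (2 * Im a * Im k + (Im k)\<^sup>2) + (2 * Re (k * w) + (cmod (l * w))\<^sup>2) + (2 * Re d * X + X\<^sup>2)"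
    unfolding tube_def nq Im_k Re_X power2_sum by linarith
  also have "\<dots> = (Im k)\<^sup>2 + (cmod (l * w))\<^sup>2 + 2 * Re d * Y + X\<^sup>2"
    using first unfolding X_def by (simp add: algebra_simps)
  finally have eq: "tube (a + l * cnj q) (q + l * w) (d + (l * (q - 1) * cnj q + l\<^sup>2 / 2 * (cnj q * w) + e)) - tube a q d
     = (Im k)\<^sup>2 + (cmod (l * w))\<^sup>2 + 2 * Re d * Y + X\<^sup>2" .
  have k: "cmod k \<le> cmod l * (1/2)" unfolding k_def norm_mult using b(2) by (intro mult_left_mono) auto
  have "\<bar>Im k\<bar> \<le> cmod l * (1/2)" using abs_Im_le_cmod[of k] k by linarith
  then have 1: "(Im k)\<^sup>2 \<le> (cmod l * (1/2))\<^sup>2" by (metis abs_ge_zero power2_abs power_mono)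
  have 2: "(cmod (l * w))\<^sup>2 \<le> (cmod l * 2)\<^sup>2"
    unfolding norm_mult using w by (intro power_mono mult_left_mono) auto
  have "cmod q * cmod w \<le> 1/2 * 2" using b w by (intro mult_mono) auto
  then have "(cmod l)\<^sup>2 / 2 * (cmod q * cmod w) \<le> (cmod l)\<^sup>2 / 2 * 1" by (intro mult_left_mono) auto
  then have "cmod (l\<^sup>2 / 2 * (cnj q * w)) \<le> (cmod l)\<^sup>2 / 2" by (simp add: norm_mult norm_divide norm_power)
  then have Y: "\<bar>Y\<bar> \<le> 3/2 * (cmod l)\<^sup>2"
    using abs_Re_le_cmod[of "l\<^sup>2 / 2 * (cnj q * w) + e"] norm_triangle_ineq[of "l\<^sup>2 / 2 * (cnj q * w)" e] e
    unfolding Y_def by linarith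
  have l2: "(cmod l)\<^sup>2 \<le> cmod l" using l by (simp add: power2_eq_square mult_left_le)
  have "cmod (q - 1) \<le> 3/2" using norm_triangle_ineq4[of q 1] b(2) by simp
  then have "cmod (k * (q - 1)) \<le> cmod l * (1/2) * (3/2)"
    unfolding norm_mult using k by (intro mult_mono) auto
  then have "\<bar>X\<bar> \<le> cmod l * (9/4)"
    unfolding X_def using abs_Re_le_cmod[of "k * (q - 1)"] Y l2 by linarith
  then have 3: "X\<^sup>2 \<le> (cmod l * (9/4))\<^sup>2" by (metis abs_ge_zero power2_abs power_mono)
  have "\<bar>2 * Re d * Y\<bar> = 2 * \<bar>Re d\<bar> * \<bar>Y\<bar>" by (simp add: abs_mult)
  also have "\<dots> \<le> 2 * (1/2) * (3/2 * (cmod l)\<^sup>2)" using b(3) Y by (intro mult_mono) auto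
  finally have 4: "\<bar>2 * Re d * Y\<bar> \<le> 3/2 * (cmod l)\<^sup>2" by simp
  have "\<bar>(Im k)\<^sup>2 + (cmod (l * w))\<^sup>2 + 2 * Re d * Y + X\<^sup>2\<bar> \<le>
     (Im k)\<^sup>2 + (cmod (l * w))\<^sup>2 + \<bar>2 * Re d * Y\<bar> + X\<^sup>2"
    using zero_le_power2[of "Im k"] zero_le_power2[of "cmod (l*w)"] zero_le_power2[of X] by linarith
  also have "\<dots> \<le> 16 * (cmod l)\<^sup>2"
    using 1 2 3 4 zero_le_power2[of "cmod l"] unfolding power_mult_distrib power_divide by simp
  finally show ?thesis unfolding eq .
qed

section \<open>Polynomial tools: oscillatory integration, conjugates on the circle\<close>

lemma poly_antiderivative_bound:
  fixes U :: "complex poly"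
  shows "\<exists>K\<ge>0. \<forall>m. \<exists>V. pderiv V = monom 1 m * U \<and> (\<forall>z. cmod z \<le> 1 \<longrightarrow> cmod (poly V z) \<le> K / (real m + 1))"
\<comment> \<open>Termwise integration: a coefficient \<open>c\<close> of \<open>U\<close> in degree
  j contributes \<open>c / (m + j + 1)\<close>, so \<open>K\<close> is the sum of the coefficient
  norms. The induction treats all \<open>m\<close> at once because passing from \<open>U\<close> to
  \<open>pCons c U\<close> shifts \<open>m\<close> by one.\<close>
proof (induction U)
  case 0
  show ?case by (intro exI[of _ 0] conjI allI exI[of _ 0]) auto
next
  case (pCons c U)
  then obtain K where K: "K \<ge> 0"
    "\<And>m. \<exists>V. pderiv V = monom 1 m * U \<and> (\<forall>z. cmod z \<le> 1 \<longrightarrow> cmod (poly V z) \<le> K / (real m + 1))"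
    by blast
  show ?case
  proof (intro exI[of _ "K + cmod c"] conjI allI)
    show "K + cmod c \<ge> 0" using K by simp
    fix m
    obtain V where V: "pderiv V = monom 1 (Suc m) * U"
      "\<And>z. cmod z \<le> 1 \<Longrightarrow> cmod (poly V z) \<le> K / (real (Suc m) + 1)" using K(2) by blast
    have e1: "pderiv (monom (c / of_nat (Suc m)) (Suc m)) = monom c m"
      unfolding pderiv_monom using of_nat_neq_0[of m, where 'a=complex] by (simp add: field_simps del: of_nat_Suc)
    have e2: "monom 1 m * pCons c U = monom c m + monom 1 (Suc m) * U"
      by (simp add: pCons_one monom_Suc mult_monom[symmetric] smult_monom algebra_simps)
    show "\<exists>V. pderiv V = monom 1 m * pCons c U \<and> (\<forall>z. cmod z \<le> 1 \<longrightarrow> cmod (poly V z) \<le> (K + cmod c) / (real m + 1))"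
    proof (intro exI[of _ "monom (c / of_nat (Suc m)) (Suc m) + V"] conjI allI impI)
      show "pderiv (monom (c / of_nat (Suc m)) (Suc m) + V) = monom 1 m * pCons c U"
        by (simp only: pderiv_add e1 e2 V)
      fix z :: complex assume z: "cmod z \<le> 1"
      have "cmod (c / of_nat (Suc m) * z ^ Suc m) = cmod c / (real m + 1) * cmod z ^ Suc m"
        unfolding norm_mult norm_divide norm_power norm_of_nat by (simp add: add.commute)
      also have "\<dots> \<le> cmod c / (real m + 1)"
        using z by (intro mult_left_le power_le_one) auto
      finally have "cmod (c / of_nat (Suc m) * z ^ Suc m) \<le> cmod c / (real m + 1)" .
      moreover have "cmod (poly V z) \<le> K / (real m + 1)"
        by (rule order_trans[OF V(2)[OF z]]) (use K in \<open>auto intro!: divide_left_mono\<close>)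
      ultimately show "cmod (poly (monom (c / of_nat (Suc m)) (Suc m) + V) z) \<le> (K + cmod c) / (real m + 1)"
        unfolding poly_add poly_monom add_divide_distrib
        using norm_triangle_ineq[of "c / of_nat (Suc m) * z ^ Suc m" "poly V z"] by linarith
    qed
  qed
qed

text \<open>On the unit circle the complex conjugate of a polynomial is a Laurent polynomial, so the tangent
  steps become genuine polynomials after multiplication by a high power of \<open>z\<close>.\<close>

definition circle_poly :: "(complex \<Rightarrow> complex) \<Rightarrow> bool" where
  "circle_poly W \<longleftrightarrow> (\<exists>N P. \<forall>z. cmod z = 1 \<longrightarrow> z ^ N * W z = poly P z)"

lemma circle_poly_poly: "circle_poly (poly p)"
  unfolding circle_poly_def by (intro exI[of _ 0] exI[of _ p]) simp

lemma circle_poly_const: "circle_poly (\<lambda>_. c)"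
  using circle_poly_poly[of "[:c:]"] by (simp add: circle_poly_def)

lemma circle_poly_mult:
  assumes "circle_poly V" "circle_poly W" shows "circle_poly (\<lambda>z. V z * W z)"
proof -
  obtain N P M Q where *: "\<And>z. cmod z = 1 \<Longrightarrow> z ^ N * V z = poly P z" "\<And>z. cmod z = 1 \<Longrightarrow> z ^ M * W z = poly Q z"
    using assms unfolding circle_poly_def by metis
  show ?thesis unfolding circle_poly_def
    by (intro exI[of _ "N+M"] exI[of _ "P*Q"]) (auto simp: power_add algebra_simps simp flip: *)
qed

lemma circle_poly_add:
  assumes "circle_poly V" "circle_poly W" shows "circle_poly (\<lambda>z. V z + W z)"
proof -
  obtain N P M Q where *: "\<And>z. cmod z = 1 \<Longrightarrow> z ^ N * V z = poly P z" "\<And>z. cmod z = 1 \<Longrightarrow> z ^ M * W z = poly Q z"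
    using assms unfolding circle_poly_def by metis
  show ?thesis unfolding circle_poly_def
    by (intro exI[of _ "N+M"] exI[of _ "monom 1 M * P + monom 1 N * Q"])
       (auto simp: power_add poly_monom algebra_simps simp flip: *)
qed

text \<open>On the circle \<open>cnj z\<close> is the inverse of \<open>z\<close>, so each Horner
  step costs one more power of \<open>z\<close>.\<close>

lemma circle_poly_cnj: "circle_poly (\<lambda>z. cnj (poly p z))"
proof (induction p)
  case 0
  then show ?case using circle_poly_const[of 0] by simp
next
  case (pCons c p)
  then obtain N P where *: "\<And>z. cmod z = 1 \<Longrightarrow> z ^ N * cnj (poly p z) = poly P z"
    unfolding circle_poly_def by metis
  show ?case unfolding circle_poly_def
  proof (intro exI allI impI)
    fix z :: complex assume z: "cmod z = 1"
    then have "z * cnj z = 1" by (simp flip: complex_norm_square)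
    then have "z ^ Suc N * (cnj c + cnj z * cnj (poly p z)) = cnj c * z ^ Suc N + z ^ N * cnj (poly p z)"
      by (simp add: algebra_simps)
    then show "z ^ Suc N * cnj (poly (pCons c p) z) = poly (monom (cnj c) (Suc N) + P) z"
      using *[OF z] by (simp add: poly_monom)
  qed
qed

text \<open>Both components need the same exponent \<open>N\<close>: then \<open>z ^ N\<close> is a
  common complex factor of the step and can be absorbed into its multiplier.\<close>

lemma circle_poly_directions:
  fixes \<alpha> q \<delta> :: "complex poly"
  shows "\<exists>N P Q. \<forall>z. cmod z = 1 \<longrightarrow> poly P z = z ^ N * cnj (poly q z) \<and>
    poly Q z = z ^ N * tube_dir (poly \<alpha> z) (poly q z) (poly \<delta> z)"
proof -
  have "(\<lambda>z. tube_dir (poly \<alpha> z) (poly q z) (poly \<delta> z)) =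
    (\<lambda>z. (1/2) * (poly \<alpha> z + (-1) * cnj (poly \<alpha> z)) + (1 + (-1) * poly q z) * ((1/2) * (poly \<delta> z + cnj (poly \<delta> z))))"
    by (rule ext) (simp add: tube_dir_def complex_eq_iff)
  moreover have "circle_poly (\<lambda>z. (1/2) * (poly \<alpha> z + (-1) * cnj (poly \<alpha> z)) + (1 + (-1) * poly q z) * ((1/2) * (poly \<delta> z + cnj (poly \<delta> z))))"
    by (intro circle_poly_add circle_poly_mult circle_poly_const circle_poly_cnj circle_poly_poly)
  ultimately have "circle_poly (\<lambda>z. tube_dir (poly \<alpha> z) (poly q z) (poly \<delta> z))" by simp
  then obtain M Q where Q: "\<And>z. cmod z = 1 \<Longrightarrow> z ^ M * tube_dir (poly \<alpha> z) (poly q z) (poly \<delta> z) = poly Q z"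
    unfolding circle_poly_def by metis
  obtain N P where P: "\<And>z. cmod z = 1 \<Longrightarrow> z ^ N * cnj (poly q z) = poly P z"
    using circle_poly_cnj[of q] unfolding circle_poly_def by metis
  show ?thesis
    by (intro exI[of _ "N + M"] exI[of _ "monom 1 M * P"] exI[of _ "monom 1 N * Q"])
       (simp add: poly_monom power_add P[symmetric] Q[symmetric] mult_ac)
qed

lemma poly_bounded_unit_disk:
  fixes p :: "complex poly"
  obtains K where "K > 0" "\<And>z. cmod z \<le> 1 \<Longrightarrow> cmod (poly p z) \<le> K"
proof -
  have "compact (poly p ` cball 0 1)" by (intro compact_continuous_image continuous_intros) auto
  then have "bounded (poly p ` cball 0 1)" by (rule compact_imp_bounded)
  then obtain K where "K > 0" "\<And>y. y \<in> poly p ` cball 0 1 \<Longrightarrow> norm y \<le> K" unfolding bounded_pos by blast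
  then show thesis using that by auto
qed

section \<open>One step of the construction\<close>

lemma poly_pderiv_monom_mult:
  "poly (pderiv (monom 1 m * U)) z = of_nat m * z ^ (m - 1) * poly U z + z ^ m * poly (pderiv U) (z::complex)"
  by (simp add: pderiv_mult pderiv_monom poly_monom)

text \<open>Geometric decay beats the factor \<open>m\<close> produced by differentiation. Thus
  adding a high power of \<open>z\<close> times a fixed polynomial hardly disturbs the curve, or its
  derivative, on a smaller disk.\<close>

lemma monom_mult_small:
  fixes U :: "complex poly"
  assumes "r < 1" "e > 0"
  shows "\<forall>\<^sub>F m in sequentially. \<forall>z. cmod z \<le> r \<longrightarrow>
     cmod (z ^ m * poly U z) \<le> e \<and> cmod (poly (pderiv (monom 1 m * U)) z) \<le> e"
proof -
  obtain K where K: "K > 0" "\<And>z. cmod z \<le> 1 \<Longrightarrow> cmod (poly U z) \<le> K" using poly_bounded_unit_disk[of U] by blast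
  obtain L where L: "L > 0" "\<And>z. cmod z \<le> 1 \<Longrightarrow> cmod (poly (pderiv U) z) \<le> L"
    using poly_bounded_unit_disk[of "pderiv U"] by blast
  \<comment> \<open>\<open>r\<close> may be zero or negative, while the bound for
    \<open>z ^ (m - 1)\<close> divides by the radius.\<close>
  define s where "s = max r (1/2)"
  have s: "0 < s" "s < 1" "r \<le> s" using assms by (auto simp: s_def)
  have l1: "(\<lambda>m. real m * s ^ m) \<longlonglongrightarrow> 0" using powser_times_n_limit_0[of s] s by simp
  have l2: "(\<lambda>m. s ^ m) \<longlonglongrightarrow> 0" using s by (intro LIMSEQ_power_zero) simp
  have "(\<lambda>m. (real m * s ^ m) * (K / s) + s ^ m * L + s ^ m * K) \<longlonglongrightarrow> 0 * (K / s) + 0 * L + 0 * K"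
    by (intro tendsto_intros l1 l2)
  then have "\<forall>\<^sub>F m in sequentially. (real m * s ^ m) * (K / s) + s ^ m * L + s ^ m * K < e"
    using assms(2) by (intro order_tendstoD(2)) auto
  then show ?thesis
  proof eventually_elim
    case (elim m)
    have pos: "0 \<le> (real m * s ^ m) * (K / s)" "0 \<le> s ^ m * L" "0 \<le> s ^ m * K" using s K L by auto
    show ?case
    proof (intro allI impI conjI)
      fix z :: complex assume z: "cmod z \<le> r"
      have z1: "cmod z \<le> 1" "cmod z \<le> s" using z s assms by auto
      have p: "cmod (z ^ m) \<le> s ^ m" unfolding norm_power using z1 by (intro power_mono) auto
      have "cmod (z ^ m * poly U z) \<le> s ^ m * K"
        unfolding norm_mult using p K z1 s by (intro mult_mono) auto
      then show "cmod (z ^ m * poly U z) \<le> e" using elim pos by linarith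
      have "cmod (z ^ m * poly (pderiv U) z) \<le> s ^ m * L"
        unfolding norm_mult using p L z1 s by (intro mult_mono) auto
      moreover have "cmod (of_nat m * z ^ (m - 1) * poly U z) \<le> (real m * s ^ m) * (K / s)"
      proof (cases m)
        case (Suc k)
        have "cmod (of_nat m * z ^ (m - 1) * poly U z) = real m * cmod z ^ k * cmod (poly U z)"
          by (simp add: norm_mult norm_power Suc del: of_nat_Suc)
        also have "\<dots> \<le> real m * s ^ k * K" using z1 K s by (intro mult_mono power_mono) auto
        also have "\<dots> = (real m * s ^ m) * (K / s)" using s Suc by simp
        finally show ?thesis .
      qed simp
      ultimately show "cmod (poly (pderiv (monom 1 m * U)) z) \<le> e"
        unfolding poly_pderiv_monom_mult
        using norm_triangle_ineq[of "of_nat m * z ^ (m - 1) * poly U z" "z ^ m * poly (pderiv U) z"] elim pos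
        by linarith
    qed
  qed
qed

text \<open>Uniform continuity, comparing \<open>z\<close> with its radial projection to the circle,
  carries half of the bound into an annulus.\<close>

lemma nonzero_near_circle:
  fixes P Q :: "complex poly"
  assumes "\<And>z. cmod z = 1 \<Longrightarrow> 1/16 \<le> cmod (poly P z) + cmod (poly Q z)"
  obtains r where "0 < r" "r < 1" "\<And>z. r \<le> cmod z \<Longrightarrow> cmod z \<le> 1 \<Longrightarrow> 1/32 \<le> cmod (poly P z) + cmod (poly Q z)"
proof -
  let ?g = "\<lambda>z. cmod (poly P z) + cmod (poly Q z)"
  have "uniformly_continuous_on (cball 0 1) ?g"
    by (intro compact_uniformly_continuous continuous_intros) auto
  then obtain d where d: "d > 0" "\<And>x y. x \<in> cball 0 1 \<Longrightarrow> y \<in> cball 0 1 \<Longrightarrow> dist y x < d \<Longrightarrow> dist (?g y) (?g x) < 1/32"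
    unfolding uniformly_continuous_on_def by (metis zero_less_divide_1_iff zero_less_numeral)
  define r where "r = max (1/2) (1 - d/2)"
  show thesis
  proof (rule that[of r])
    show "0 < r" "r < 1" using d by (auto simp: r_def)
    fix z :: complex assume z: "r \<le> cmod z" "cmod z \<le> 1"
    have z0: "cmod z > 0" using z(1) by (auto simp: r_def)
    define y where "y = z / of_real (cmod z)"
    have y: "cmod y = 1" using z0 by (simp add: y_def norm_divide)
    have "y - z = y * of_real (1 - cmod z)" using z0 by (auto simp: y_def field_simps)
    then have "dist y z = 1 - cmod z" using z y by (simp only: dist_norm norm_mult norm_of_real) simp
    also have "\<dots> < d" using z d by (auto simp: r_def)
    finally have "dist (?g y) (?g z) < 1/32" using d(2)[of z y] y z by simp
    then show "1/32 \<le> ?g z" using assms[OF y] unfolding dist_real_def by linarith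
  qed
qed

text \<open>The contact equation for the modified curve, isolated as pure ring algebra: names ending
  in \<open>1\<close> stand for derivatives, \<open>X\<close> for \<open>z ^ m\<close>,
  \<open>H\<close> for one half. The last two summands on the left are the integration-by-parts
  remainders, which contain no \<open>X1\<close> and hence no factor \<open>m\<close>.\<close>

lemma step_derivative_identity:
  fixes c H q q1 a1 d1 X X1 P P1 Q Q1 :: "'a::comm_ring_1"
  assumes "H + H = 1" "d1 = (q - 1) * a1"
  shows "d1 + c * (X1 * (q - 1) * P + X * q1 * P + X * (q - 1) * P1)
      + H * c * c * (X1 * X * P * Q + X * X1 * P * Q + X * X * P1 * Q + X * X * P * Q1)
      + c * (X * (Q * a1 - q1 * P)) + H * c * c * (X * X * (P1 * Q - P * Q1))
     = (q + c * (X * Q) - 1) * (a1 + c * (X1 * P + X * P1))" (is "?L = ?R")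
proof -
  define u where "u = c * c * X * X1 * P * Q"
  define v where "v = c * c * X * X * P1 * Q"
  have H: "H * y + H * y = y" for y using assms(1) by (simp flip: distrib_right)
  have "?L = ?R + (H * u + H * u - u) + (H * v + H * v - v)"
    unfolding assms(2) u_def v_def by (simp add: algebra_simps)
  then show ?thesis by (simp add: H)
qed

text \<open>The step adds \<open>a z ^ m\<close> times the polynomial tangent directions, with
  \<open>m\<close> large. On the circle \<open>tube_step\<close> applies, deep inside nothing much
  changes, and near the circle the derivative has size about \<open>a * m\<close>. Since
  \<open>m \<ge> 2\<close>, the linear coefficient of \<open>q\<close> is preserved, which later
  shows that the limit of \<open>q\<close> is not constant. The surplus 3 in the lower bound pays
  for the passage to the limit and for a later perturbation.\<close>

lemma tube_curve_step:
  fixes \<alpha> q \<delta> :: "complex poly" and a r e :: real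
  assumes rel: "pderiv \<delta> = (q - 1) * pderiv \<alpha>"
    and t: "\<And>z. cmod z = 1 \<Longrightarrow> 1/32 \<le> tube (poly \<alpha> z) (poly q z) (poly \<delta> z)"
           "\<And>z. cmod z = 1 \<Longrightarrow> tube (poly \<alpha> z) (poly q z) (poly \<delta> z) \<le> 1/4"
    and a: "0 < a" "a \<le> 1" and r: "r < 1" and e: "e > 0"
  obtains \<alpha>' q' \<delta>' :: "complex poly" and r1 r2 B :: real where
    "pderiv \<delta>' = (q' - 1) * pderiv \<alpha>'"
    "\<And>z. cmod z = 1 \<Longrightarrow> \<bar>tube (poly \<alpha>' z) (poly q' z) (poly \<delta>' z) - tube (poly \<alpha> z) (poly q z) (poly \<delta> z)\<bar> \<le> 16 * a\<^sup>2"
    "coeff q' 1 = coeff q 1"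
    "\<And>z. cmod z \<le> r \<Longrightarrow> cmod (poly \<alpha>' z - poly \<alpha> z) \<le> e"
    "\<And>z. cmod z \<le> r \<Longrightarrow> cmod (poly q' z - poly q z) \<le> e"
    "\<And>z. cmod z \<le> r \<Longrightarrow> cmod (poly \<delta>' z - poly \<delta> z) \<le> e"
    "\<And>z. cmod z \<le> r \<Longrightarrow> cmod (poly (pderiv \<alpha>') z - poly (pderiv \<alpha>) z) \<le> e"
    "\<And>z. cmod z \<le> r \<Longrightarrow> cmod (poly (pderiv q') z - poly (pderiv q) z) \<le> e"
    "r < r1" "r1 < r2" "r2 < 1" "0 < B" "a / 512 \<le> B * (r2 - r1)"
    "\<And>z. r1 \<le> cmod z \<Longrightarrow> cmod z \<le> r2 \<Longrightarrow> B + 3 \<le> cmod (poly (pderiv \<alpha>') z) + cmod (poly (pderiv q') z)"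
proof -
  obtain N P Q where "\<forall>z. cmod z = 1 \<longrightarrow> poly P z = z ^ N * cnj (poly q z) \<and>
      poly Q z = z ^ N * tube_dir (poly \<alpha> z) (poly q z) (poly \<delta> z)"
    using circle_poly_directions[of q \<alpha> \<delta>] by (elim exE)
  then have P: "\<And>z. cmod z = 1 \<Longrightarrow> poly P z = z ^ N * cnj (poly q z)"
    and Q: "\<And>z. cmod z = 1 \<Longrightarrow> poly Q z = z ^ N * tube_dir (poly \<alpha> z) (poly q z) (poly \<delta> z)"
    by auto
  define U1 where "U1 = Q * pderiv \<alpha> - pderiv q * P"
  define U2 where "U2 = pderiv P * Q - P * pderiv Q"
  obtain K1 V1 where K1: "K1 \<ge> 0" "\<And>m. pderiv (V1 m) = monom 1 m * U1"
      "\<And>m z. cmod z \<le> 1 \<Longrightarrow> cmod (poly (V1 m) z) \<le> K1 / (real m + 1)"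
    using poly_antiderivative_bound[of U1] unfolding choice_iff by auto
  obtain K2 V2 where K2: "K2 \<ge> 0" "\<And>m. pderiv (V2 m) = monom 1 m * U2"
      "\<And>m z. cmod z \<le> 1 \<Longrightarrow> cmod (poly (V2 m) z) \<le> K2 / (real m + 1)"
    using poly_antiderivative_bound[of U2] unfolding choice_iff by auto
  have "1/16 \<le> cmod (poly P z) + cmod (poly Q z)" if "cmod z = 1" for z
    using tube_dir_lower[OF t(2)[OF that] t(1)[OF that]] P[OF that] Q[OF that] that
    by (simp add: norm_mult norm_power)
  then obtain r0 where r0: "0 < r0" "r0 < 1"
      "\<And>z. r0 \<le> cmod z \<Longrightarrow> cmod z \<le> 1 \<Longrightarrow> 1/32 \<le> cmod (poly P z) + cmod (poly Q z)"
    using nonzero_near_circle[of P Q] by blast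
  obtain L1 where L1: "L1 > 0" "\<And>z. cmod z \<le> 1 \<Longrightarrow> cmod (poly (pderiv \<alpha>) z) \<le> L1"
    using poly_bounded_unit_disk[of "pderiv \<alpha>"] by blast
  obtain L2 where L2: "L2 > 0" "\<And>z. cmod z \<le> 1 \<Longrightarrow> cmod (poly (pderiv q) z) \<le> L2"
    using poly_bounded_unit_disk[of "pderiv q"] by blast
  obtain L3 where L3: "L3 > 0" "\<And>z. cmod z \<le> 1 \<Longrightarrow> cmod (poly (pderiv P) z) \<le> L3"
    using poly_bounded_unit_disk[of "pderiv P"] by blast
  obtain L4 where L4: "L4 > 0" "\<And>z. cmod z \<le> 1 \<Longrightarrow> cmod (poly (pderiv Q) z) \<le> L4"
    using poly_bounded_unit_disk[of "pderiv Q"] by blast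
  have e3: "e / 3 > 0" using e by simp
  define L where "L = L1 + L2 + L3 + L4"
  have lim: "(\<lambda>m. (K1 + K2) / (real m + 1)) \<longlonglongrightarrow> 0" by real_asymp
  have lim2: "(\<lambda>m. 1 - 1 / (2 * real m)) \<longlonglongrightarrow> 1" by real_asymp
  have "\<forall>\<^sub>F m in sequentially. 128 * (L + 3) / a \<le> real m" by real_asymp
  moreover have "\<forall>\<^sub>F m in sequentially. (K1 + K2) / (real m + 1) < min (a\<^sup>2) (e/3)"
    using a e by (intro order_tendstoD(2)[OF lim]) auto
  moreover have "\<forall>\<^sub>F m in sequentially. max r r0 < 1 - 1 / (2 * real m)"
    using r r0 by (intro order_tendstoD(1)[OF lim2]) auto
  moreover note eventually_ge_at_top[of "2::nat"] 
  moreover note monom_mult_small[OF r e, of P] monom_mult_small[OF r e, of Q]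
    monom_mult_small[OF r e3, of "(q - 1) * P"] monom_mult_small[OF r e3, of "P * Q"]
  ultimately have "\<forall>\<^sub>F m in sequentially. 128 * (L + 3) / a \<le> real m \<and> (K1 + K2) / (real m + 1) < min (a\<^sup>2) (e/3) \<and>
     max r r0 < 1 - 1 / (2 * real m) \<and> m \<ge> 2 \<and> (\<forall>z. cmod z \<le> r \<longrightarrow>
     cmod (z ^ m * poly P z) \<le> e \<and> cmod (poly (pderiv (monom 1 m * P)) z) \<le> e \<and>
     cmod (z ^ m * poly Q z) \<le> e \<and> cmod (poly (pderiv (monom 1 m * Q)) z) \<le> e \<and>
     cmod (z ^ m * poly ((q - 1) * P) z) \<le> e/3 \<and> cmod (z ^ m * poly (P * Q) z) \<le> e/3)"
    by eventually_elim simp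
  from eventually_happens'[OF sequentially_bot this] obtain m where "128 * (L + 3) / a \<le> real m \<and> (K1 + K2) / (real m + 1) < min (a\<^sup>2) (e/3) \<and>
     max r r0 < 1 - 1 / (2 * real m) \<and> m \<ge> 2 \<and> (\<forall>z. cmod z \<le> r \<longrightarrow>
     cmod (z ^ m * poly P z) \<le> e \<and> cmod (poly (pderiv (monom 1 m * P)) z) \<le> e \<and>
     cmod (z ^ m * poly Q z) \<le> e \<and> cmod (poly (pderiv (monom 1 m * Q)) z) \<le> e \<and>
     cmod (z ^ m * poly ((q - 1) * P) z) \<le> e/3 \<and> cmod (z ^ m * poly (P * Q) z) \<le> e/3)"
    by (elim exE)
  then have mL: "128 * (L + 3) / a \<le> real m" and mK: "(K1 + K2) / (real m + 1) < a\<^sup>2" "(K1 + K2) / (real m + 1) < e/3"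
    and mr: "r < 1 - 1 / (2 * real m)" "r0 < 1 - 1 / (2 * real m)" and m2: "m \<ge> 2"
    and small: "\<And>z. cmod z \<le> r \<Longrightarrow> cmod (z ^ m * poly P z) \<le> e"
      "\<And>z. cmod z \<le> r \<Longrightarrow> cmod (poly (pderiv (monom 1 m * P)) z) \<le> e"
      "\<And>z. cmod z \<le> r \<Longrightarrow> cmod (z ^ m * poly Q z) \<le> e"
      "\<And>z. cmod z \<le> r \<Longrightarrow> cmod (poly (pderiv (monom 1 m * Q)) z) \<le> e"
      "\<And>z. cmod z \<le> r \<Longrightarrow> cmod (z ^ m * poly ((q - 1) * P) z) \<le> e/3"
      "\<And>z. cmod z \<le> r \<Longrightarrow> cmod (z ^ m * poly (P * Q) z) \<le> e/3"
    by auto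
  define X :: "complex poly" where "X = monom 1 m"
  define c :: "complex poly" where "c = [:of_real a:]"
  define H :: "complex poly" where "H = [:1/2:]"
  \<comment> \<open>\<open>E\<close> is what remains of the integral of \<open>(q' - 1) d\<alpha>'\<close> after integrating the terms
    of top order in \<open>m\<close> by parts; it is \<open>O(1/m)\<close> on the closed disk.\<close>
  define E where "E = c * V1 m + H * c * c * V2 (2 * m)"
  define \<alpha>' where "\<alpha>' = \<alpha> + c * (X * P)"
  define q' where "q' = q + c * (X * Q)"
  define \<delta>' where "\<delta>' = \<delta> + c * (X * (q - 1) * P) + H * c * c * (X * X * P * Q) + E"
  have XX: "monom 1 (2 * m) = X * X" by (simp add: X_def mult_monom mult_2)
  have pX: "poly X z = z ^ m" and pc: "poly c z = of_real a" and pH: "poly H z = 1/2" for z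
    by (simp_all add: X_def c_def H_def poly_monom)
  have dc: "pderiv c = 0" "pderiv H = 0" by (simp_all add: c_def H_def pderiv_pCons)
  have HH: "H + H = 1" by (simp add: H_def pCons_one)
  have E_bound: "cmod (poly E z) \<le> (K1 + K2) / (real m + 1)" if "cmod z \<le> 1" for z
  proof -
    have 1: "cmod (of_real a * poly (V1 m) z) \<le> 1 * (K1 / (real m + 1))"
      unfolding norm_mult using a K1(3)[OF that] by (intro mult_mono) auto
    have "cmod (of_real a * of_real a / 2) \<le> 1"
      using a mult_le_one[of a a] by (simp add: norm_mult norm_divide)
    moreover have "cmod (poly (V2 (2*m)) z) \<le> K2 / (real m + 1)"
      by (rule order_trans[OF K2(3)[OF that]]) (use K2 in \<open>auto intro!: divide_left_mono\<close>)
    ultimately have 2: "cmod (of_real a * of_real a / 2 * poly (V2 (2*m)) z) \<le> 1 * (K2 / (real m + 1))"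
      unfolding norm_mult[of _ "poly _ _"] by (intro mult_mono) auto
    have "poly E z = of_real a * poly (V1 m) z + of_real a * of_real a / 2 * poly (V2 (2*m)) z"
      by (simp add: E_def pc pH)
    then have "cmod (poly E z) \<le> cmod (of_real a * poly (V1 m) z) + cmod (of_real a * of_real a / 2 * poly (V2 (2*m)) z)"
      by (simp only: norm_triangle_ineq)
    then show ?thesis using 1 2 unfolding mult_1 add_divide_distrib by linarith
  qed
  have d\<alpha>: "pderiv \<alpha>' = pderiv \<alpha> + c * pderiv (X * P)" and dq: "pderiv q' = pderiv q + c * pderiv (X * Q)"
    unfolding \<alpha>'_def q'_def pderiv_add pderiv_mult[of c] dc by simp_all
  have a_le: "cmod (of_real a * w) \<le> y" if "cmod w \<le> y" for w y
  proof -
    have "cmod (of_real a * w) = a * cmod w" using a by (simp add: norm_mult)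
    also have "\<dots> \<le> 1 * cmod w" using a by (intro mult_right_mono) auto
    finally show ?thesis using that by simp
  qed
  have tri: "cmod (x + y + w) \<le> e" if "cmod x \<le> e / 3" "cmod y \<le> e / 3" "cmod w \<le> e / 3" for x y w
    using that norm_triangle_ineq[of "x + y" w] norm_triangle_ineq[of x y] by linarith
  \<comment> \<open>The annulus has width \<open>1 / (4 * real m)\<close>. Its inner radius is
    chosen so that Bernoulli's inequality gives \<open>cmod z ^ m \<ge> 1/2\<close> on it; its outer
    radius stays below 1.\<close>
  define r1 where "r1 = 1 - 1 / (2 * real m)"
  define r2 where "r2 = 1 - 1 / (4 * real m)"
  \<comment> \<open>The main term of the derivative is at least \<open>a * real m / 64\<close>, that
    is \<open>2 * B\<close>; one \<open>B\<close> is kept, and the other absorbs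
    \<open>L + 3\<close> because \<open>m\<close> was taken large.\<close>
  define B where "B = a * real m / 128"
  have m0: "real m > 0" using m2 by simp
  show thesis
  proof (rule that[of \<delta>' q' \<alpha>' r1 r2 B])
    have "pderiv \<delta>' = pderiv \<delta> + c * (pderiv X * (q - 1) * P + X * pderiv q * P + X * (q - 1) * pderiv P)
      + H * c * c * (pderiv X * X * P * Q + X * pderiv X * P * Q + X * X * pderiv P * Q + X * X * P * pderiv Q)
      + c * (X * (Q * pderiv \<alpha> - pderiv q * P)) + H * c * c * (X * X * (pderiv P * Q - P * pderiv Q))"
      unfolding \<delta>'_def E_def
      by (simp add: pderiv_add pderiv_diff pderiv_mult dc K1(2) K2(2) XX U1_def U2_def flip: X_def)
         (simp add: algebra_simps)
    also have "\<dots> = (q + c * (X * Q) - 1) * (pderiv \<alpha> + c * (pderiv X * P + X * pderiv P))"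
      by (rule step_derivative_identity[OF HH rel])
    also have "\<dots> = (q' - 1) * pderiv \<alpha>'"
      unfolding d\<alpha> q'_def pderiv_mult[of X] by (simp add: mult_ac add_ac)
    finally show "pderiv \<delta>' = (q' - 1) * pderiv \<alpha>'" .
  next
    fix z :: complex assume z: "cmod z = 1"
    \<comment> \<open>On the circle the increments are exactly those of \<open>tube_step\<close>
      with multiplier \<open>l\<close> of modulus \<open>a\<close> and error
      \<open>poly E z\<close>.\<close>
    define l where "l = of_real a * z ^ (m + N)"
    have l: "cmod l = a" using a z by (simp add: l_def norm_mult norm_power)
    have "poly \<alpha>' z = poly \<alpha> z + l * cnj (poly q z)"
      by (simp add: \<alpha>'_def pX pc P[OF z] l_def power_add)
    moreover have "poly q' z = poly q z + l * tube_dir (poly \<alpha> z) (poly q z) (poly \<delta> z)"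
      by (simp add: q'_def pX pc Q[OF z] l_def power_add)
    moreover have "poly \<delta>' z = poly \<delta> z + (l * (poly q z - 1) * cnj (poly q z)
        + l\<^sup>2 / 2 * (cnj (poly q z) * tube_dir (poly \<alpha> z) (poly q z) (poly \<delta> z)) + poly E z)"
      by (simp add: \<delta>'_def pX pc pH P[OF z] Q[OF z] l_def power_add power2_eq_square)
    moreover have "cmod (poly E z) \<le> (cmod l)\<^sup>2" using E_bound[of z] z mK(1) l by simp
    ultimately show "\<bar>tube (poly \<alpha>' z) (poly q' z) (poly \<delta>' z) - tube (poly \<alpha> z) (poly q z) (poly \<delta> z)\<bar> \<le> 16 * a\<^sup>2"
      using tube_step[OF t(2)[OF z], of l "poly E z"] l a by simp
  next
    show "coeff q' 1 = coeff q 1"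
      using m2 by (simp add: q'_def c_def X_def coeff_monom_mult)
  next
    fix z :: complex assume z: "cmod z \<le> r"
    show "cmod (poly \<alpha>' z - poly \<alpha> z) \<le> e" using a_le[OF small(1)[OF z]] by (simp add: \<alpha>'_def pX pc)
    show "cmod (poly q' z - poly q z) \<le> e" using a_le[OF small(3)[OF z]] by (simp add: q'_def pX pc)
    show "cmod (poly (pderiv \<alpha>') z - poly (pderiv \<alpha>) z) \<le> e"
      using a_le[OF small(2)[OF z]] by (simp add: d\<alpha> pc X_def)
    show "cmod (poly (pderiv q') z - poly (pderiv q) z) \<le> e"
      using a_le[OF small(4)[OF z]] by (simp add: dq pc X_def)
    have z1: "cmod z \<le> 1" using z r by simp
    have zm: "cmod (1 / 2 * z ^ m) \<le> 1" using z1 by (simp add: norm_mult norm_power norm_divide)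
      (meson norm_ge_zero one_le_numeral order_trans power_le_one)
    have "cmod ((1 / 2 * z ^ m) * (z ^ m * poly (P * Q) z)) \<le> 1 * (e / 3)"
      unfolding norm_mult[of "1 / 2 * z ^ m"] using zm small(6)[OF z] by (intro mult_mono) auto
    then have "cmod (of_real a * (of_real a * ((1 / 2 * z ^ m) * (z ^ m * poly (P * Q) z)))) \<le> e / 3"
      by (intro a_le) simp
    moreover have "cmod (of_real a * (z ^ m * poly ((q - 1) * P) z)) \<le> e / 3" by (rule a_le[OF small(5)[OF z]])
    moreover have "cmod (poly E z) \<le> e / 3" using E_bound[OF z1] mK(2) by linarith
    moreover have "poly \<delta>' z - poly \<delta> z = of_real a * (z ^ m * poly ((q - 1) * P) z)
        + of_real a * (of_real a * ((1 / 2 * z ^ m) * (z ^ m * poly (P * Q) z))) + poly E z"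
      by (simp add: \<delta>'_def pX pc pH)
    ultimately show "cmod (poly \<delta>' z - poly \<delta> z) \<le> e"
      by (simp only: tri)
  next
    show "r < r1" using mr by (simp add: r1_def)
    show "r1 < r2" "r2 < 1" using m0 by (auto simp: r1_def r2_def field_simps)
    show "0 < B" using a m0 by (simp add: B_def)
    show "a / 512 \<le> B * (r2 - r1)" using m0 by (simp add: B_def r1_def r2_def field_simps)
    fix z :: complex assume z: "r1 \<le> cmod z" "cmod z \<le> r2"
    have z1: "cmod z \<le> 1" using z \<open>r2 < 1\<close> by simp
    have r1: "r1 \<ge> 1/2" using m2 by (simp add: r1_def field_simps)
    have "1/2 \<le> 1 + real m * (r1 - 1)" using m0 by (simp add: r1_def field_simps)
    also have "\<dots> \<le> (1 + (r1 - 1)) ^ m" using r1 by (intro Bernoulli_inequality) auto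
    also have "\<dots> \<le> cmod z ^ m" using z r1 by (intro power_mono) auto
    also have "\<dots> \<le> cmod z ^ (m - 1)" using z1 by (intro power_decreasing) auto
    finally have zm: "1/2 \<le> cmod z ^ (m - 1)" .
    have zm1: "cmod (z ^ m) \<le> 1" using z1 by (simp add: norm_power power_le_one)
    have lower: "a * real m * cmod z ^ (m - 1) * cmod (poly W z) - (M + M') \<le> cmod (poly (p + c * pderiv (X * W)) z)"
      if "cmod (poly p z) \<le> M" "cmod (poly (pderiv W) z) \<le> M'" for p W M M'
    proof -
      let ?u = "of_real a * (of_nat m * z ^ (m - 1) * poly W z)" and ?v = "of_real a * (z ^ m * poly (pderiv W) z)"
      have "cmod (z ^ m * poly (pderiv W) z) \<le> 1 * M'"
        unfolding norm_mult using zm1 that by (intro mult_mono) auto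
      then have "cmod ?v \<le> M'" by (intro a_le) simp
      moreover have "cmod ?u = a * real m * cmod z ^ (m - 1) * cmod (poly W z)"
        using a by (simp add: norm_mult norm_power)
      moreover have "poly (p + c * pderiv (X * W)) z = ?u + (poly p z + ?v)"
        unfolding X_def poly_add poly_mult[of c] poly_pderiv_monom_mult pc by (simp add: algebra_simps)
      ultimately show ?thesis
        using that norm_triangle_ineq[of "poly p z" ?v] norm_diff_ineq[of ?u "poly p z + ?v"]
        by (simp only:)
    qed
    have "a * real m * (1/2) * (1/32) \<le> a * real m * cmod z ^ (m - 1) * (cmod (poly P z) + cmod (poly Q z))"
      using a zm r0(3)[of z] z z1 mr(2) by (intro mult_mono) (auto simp: r1_def)
    moreover have "128 * (L + 3) \<le> a * real m" using mL a by (simp add: field_simps)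
    ultimately show "B + 3 \<le> cmod (poly (pderiv \<alpha>') z) + cmod (poly (pderiv q') z)"
      unfolding d\<alpha> dq
      using lower[OF L1(2)[OF z1] L3(2)[OF z1]] lower[OF L2(2)[OF z1] L4(2)[OF z1]]
      by (simp add: B_def L_def algebra_simps)
  qed
qed

section \<open>Lengths, limits and maximum principles\<close>

text \<open>Take \<open>t\<close> as the first time at which \<open>u\<close> reaches
  \<open>b\<close>, and \<open>s\<close> as the last time before \<open>t\<close> with
  \<open>u \<le> a\<close>; in between \<open>u\<close> cannot leave the strip.\<close>

lemma crossing_interval:
  fixes u :: "real \<Rightarrow> real"
  assumes cont: "continuous_on {0..T} u" and "0 \<le> T" "u 0 < a" "a < b" "b \<le> u T"
  obtains s t where "0 \<le> s" "s < t" "t \<le> T" "u s = a" "u t = b" "\<And>x. x \<in> {s..t} \<Longrightarrow> a \<le> u x \<and> u x \<le> b"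
proof -
  let ?A = "{x \<in> {0..T}. b \<le> u x}"
  have "closed ?A" using cont by (intro continuous_on_closed_Collect_le continuous_intros) auto
  moreover have "bounded ?A" by (rule bounded_subset[of "{0..T}"]) auto
  ultimately have "compact ?A" by (simp add: compact_eq_bounded_closed)
  moreover have "T \<in> ?A" using assms by auto
  ultimately obtain t where t: "t \<in> ?A" "\<And>x. x \<in> ?A \<Longrightarrow> t \<le> x"
    using compact_attains_inf[of ?A] by blast
  have ct: "continuous_on {0..t} u" using t by (intro continuous_on_subset[OF cont]) auto
  have ut: "u t = b"
  proof (rule ccontr)
    assume "u t \<noteq> b"
    obtain x where x: "0 \<le> x" "x \<le> t" "u x = b"
      using IVT'[of u 0 b t] ct t assms by auto
    then have "x \<in> ?A" using t by auto
    then show False using t(2)[of x] x \<open>u t \<noteq> b\<close> by auto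
  qed
  let ?B = "{x \<in> {0..t}. u x \<le> a}"
  have "closed ?B" using ct by (intro continuous_on_closed_Collect_le continuous_intros) auto
  moreover have "bounded ?B" by (rule bounded_subset[of "{0..t}"]) auto
  ultimately have "compact ?B" by (simp add: compact_eq_bounded_closed)
  moreover have "0 \<in> ?B" using assms t by auto
  ultimately obtain s where s: "s \<in> ?B" "\<And>x. x \<in> ?B \<Longrightarrow> x \<le> s"
    using compact_attains_sup[of ?B] by blast
  have us: "u s = a"
  proof (rule ccontr)
    assume "u s \<noteq> a"
    have "continuous_on {s..t} u" using s by (intro continuous_on_subset[OF ct]) auto
    then obtain x where x: "s \<le> x" "x \<le> t" "u x = a"
      using IVT'[of u s a t] s ut assms by auto
    then have "x \<in> ?B" using s by auto
    then show False using s(2)[of x] x \<open>u s \<noteq> a\<close> by auto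
  qed
  show thesis
  proof (rule that[of s t])
    show "0 \<le> s" "t \<le> T" "u s = a" "u t = b" using s t us ut by auto
    have "s \<noteq> t" using us ut assms by auto
    then show "s < t" using s by auto
    fix x assume x: "x \<in> {s..t}"
    show "a \<le> u x \<and> u x \<le> b"
    proof
      show "a \<le> u x"
      proof (rule ccontr)
        assume "\<not> a \<le> u x"
        then have "x \<le> s" using s(1) x by (intro s(2)) auto
        then show False using x us \<open>\<not> a \<le> u x\<close> by auto
      qed
      show "u x \<le> b"
      proof (rule ccontr)
        assume "\<not> u x \<le> b"
        then have "t \<le> x" using s(1) t(1) x by (intro t(2)) auto
        then show False using x ut \<open>\<not> u x \<le> b\<close> by auto
      qed
    qed
  qed
qed

lemma chord_le_nn_integral:
  fixes \<gamma> \<gamma>' :: "real \<Rightarrow> complex"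
  assumes "s \<le> t" and d: "\<And>x. x \<in> {s..t} \<Longrightarrow> (\<gamma> has_vector_derivative \<gamma>' x) (at x within {s..t})"
    and c: "continuous_on {s..t} \<gamma>'"
  shows "ennreal (norm (\<gamma> t - \<gamma> s)) \<le> (\<integral>\<^sup>+ x. ennreal (indicator {s..t} x * norm (\<gamma>' x)) \<partial>lborel)"
proof -
  have i: "(\<gamma>' has_integral (\<gamma> t - \<gamma> s)) {s..t}"
    using assms by (intro fundamental_theorem_of_calculus) auto
  have j: "(\<lambda>x. norm (\<gamma>' x)) integrable_on {s..t}"
    by (intro integrable_continuous_interval continuous_intros c)
  have "norm (\<gamma> t - \<gamma> s) \<le> integral {s..t} (\<lambda>x. norm (\<gamma>' x))"
    using integral_norm_bound_integral[of \<gamma>' "{s..t}" "\<lambda>x. norm (\<gamma>' x)"] i j by (auto simp: has_integral_iff)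
  then have "ennreal (norm (\<gamma> t - \<gamma> s)) \<le> ennreal (integral {s..t} (\<lambda>x. norm (\<gamma>' x)))" by (rule ennreal_leI)
  also have "\<dots> = (\<integral>\<^sup>+ x. ennreal (indicator {s..t} x * norm (\<gamma>' x)) \<partial>lborel)"
    using nn_integral_has_integral_lebesgue[of "{s..t}" "\<lambda>x. norm (\<gamma>' x)"] j by (simp add: has_integral_integral)
  finally show ?thesis .
qed

text \<open>A curve tending to the circle must cross all but finitely many of the disjoint annuli.
  Crossing the annulus of index \<open>k\<close> costs length at least
  \<open>B k * (r2 k - r1 k)\<close>, and these crossings occupy disjoint time intervals, so the
  costs add up to a divergent series.\<close>

lemma infinite_length_crossing_annuli:
  fixes \<gamma> \<gamma>' :: "real \<Rightarrow> complex" and l :: "complex \<Rightarrow> real" and r1 r2 B c :: "nat \<Rightarrow> real"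
  assumes r: "\<And>k. r1 k < r2 k" "\<And>k. r2 k < r1 (Suc k)" "\<And>k. r2 k < 1" and lim: "r1 \<longlonglongrightarrow> 1"
    and B: "\<And>k. 0 \<le> B k" "\<And>k z. r1 k \<le> cmod z \<Longrightarrow> cmod z \<le> r2 k \<Longrightarrow> B k \<le> l z"
    and c: "\<And>k. 0 \<le> c k" "\<And>k. c k \<le> B k * (r2 k - r1 k)" "\<not> summable c"
    and \<gamma>: "\<And>t. t \<in> {0..<1} \<Longrightarrow> (\<gamma> has_vector_derivative \<gamma>' t) (at t within {0..<1})"
      "continuous_on {0..<1} \<gamma>'" "cmod (\<gamma> 0) < 1" "((\<lambda>t. norm (\<gamma> t)) \<longlongrightarrow> 1) (at_left 1)"
  shows "(\<integral>\<^sup>+ t. ennreal (indicator {0..<1} t * (l (\<gamma> t) * norm (\<gamma>' t))) \<partial>lborel) = \<infinity>" (is "?I = _")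
proof -
  have cont: "continuous_on {0..<1} \<gamma>"
    using \<gamma>(1) has_vector_derivative_continuous continuous_on_eq_continuous_within by blast
  \<comment> \<open>From \<open>k0\<close> on, the starting point lies inside the inner circle, so
    that the annulus must be crossed.\<close>
  obtain k0 where k0: "\<And>k. k \<ge> k0 \<Longrightarrow> cmod (\<gamma> 0) < r1 k"
    using order_tendstoD(1)[OF lim \<gamma>(3)] unfolding eventually_sequentially by blast
  have "\<exists>s t. 0 \<le> s \<and> s < t \<and> t < 1 \<and> cmod (\<gamma> s) = r1 k \<and> cmod (\<gamma> t) = r2 k \<and>
      (\<forall>x\<in>{s..t}. r1 k \<le> cmod (\<gamma> x) \<and> cmod (\<gamma> x) \<le> r2 k)" if "k \<ge> k0" for k
  proof -
    have "\<forall>\<^sub>F t in at_left (1::real). r2 k < norm (\<gamma> t)" using order_tendstoD(1)[OF \<gamma>(4)] r(3) by blast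
    moreover have "\<forall>\<^sub>F t in at_left (1::real). t \<in> {0<..<1}" by (rule eventually_at_leftI[of 0]) auto
    ultimately have "\<forall>\<^sub>F t in at_left (1::real). r2 k < norm (\<gamma> t) \<and> t \<in> {0<..<1}" by (rule eventually_conj)
    then obtain T where T: "r2 k < norm (\<gamma> T)" "T \<in> {0<..<1}"
      using eventually_happens'[OF trivial_limit_at_left_real] by blast
    have "continuous_on {0..T} (\<lambda>x. cmod (\<gamma> x))"
      using T by (intro continuous_intros continuous_on_subset[OF cont]) auto
    from crossing_interval[OF this, of "r1 k" "r2 k"] T k0[OF that] r(1)
    obtain s t where "0 \<le> s" "s < t" "t \<le> T" "cmod (\<gamma> s) = r1 k" "cmod (\<gamma> t) = r2 k"
      "\<And>x. x \<in> {s..t} \<Longrightarrow> r1 k \<le> cmod (\<gamma> x) \<and> cmod (\<gamma> x) \<le> r2 k" by (metis greaterThanLessThan_iff less_imp_le)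
    then show ?thesis using T by (intro exI[of _ s] exI[of _ t]) auto
  qed
  then have "\<forall>k. \<exists>s t. k0 \<le> k \<longrightarrow> 0 \<le> s \<and> s < t \<and> t < 1 \<and> cmod (\<gamma> s) = r1 k \<and> cmod (\<gamma> t) = r2 k \<and>
      (\<forall>x\<in>{s..t}. r1 k \<le> cmod (\<gamma> x) \<and> cmod (\<gamma> x) \<le> r2 k)" by blast
  then obtain s t where "\<forall>k\<ge>k0. 0 \<le> s k \<and> s k < t k \<and> t k < 1 \<and> cmod (\<gamma> (s k)) = r1 k \<and> cmod (\<gamma> (t k)) = r2 k \<and>
      (\<forall>x\<in>{s k..t k}. r1 k \<le> cmod (\<gamma> x) \<and> cmod (\<gamma> x) \<le> r2 k)" unfolding choice_iff by (elim exE)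
  then have st: "\<And>k. k \<ge> k0 \<Longrightarrow> 0 \<le> s k" "\<And>k. k \<ge> k0 \<Longrightarrow> s k < t k" "\<And>k. k \<ge> k0 \<Longrightarrow> t k < 1"
     "\<And>k. k \<ge> k0 \<Longrightarrow> cmod (\<gamma> (s k)) = r1 k" "\<And>k. k \<ge> k0 \<Longrightarrow> cmod (\<gamma> (t k)) = r2 k"
     "\<And>k x. k \<ge> k0 \<Longrightarrow> x \<in> {s k..t k} \<Longrightarrow> r1 k \<le> cmod (\<gamma> x)"
     "\<And>k x. k \<ge> k0 \<Longrightarrow> x \<in> {s k..t k} \<Longrightarrow> cmod (\<gamma> x) \<le> r2 k"
    by simp_all
  have mono: "r2 j < r1 k" if "j < k" for j k
  proof -
    have m: "r1 n \<le> r1 (Suc n)" for n using r(1)[of n] r(2)[of n] by linarith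
    have "Suc j \<le> k" using that by simp
    then have "r1 (Suc j) \<le> r1 k" by (rule lift_Suc_mono_le[of r1, OF m])
    then show ?thesis using r(2)[of j] by simp
  qed
  have disj: "j = k" if "j \<ge> k0" "k \<ge> k0" "x \<in> {s j..t j}" "x \<in> {s k..t k}" for j k x
    using st(6,7)[of j x] st(6,7)[of k x] mono[of j k] mono[of k j] that
    by (cases j k rule: linorder_cases) auto
  define h where "h k x = indicator {s k..t k} x * norm (\<gamma>' x)" for k x
  have sub: "{s k..t k} \<subseteq> {0..<1}" if "k \<ge> k0" for k using st(1,3)[OF that] by auto
  have meas: "(\<lambda>x. ennreal (h k x)) \<in> borel_measurable lborel" if "k \<ge> k0" for k
    using borel_measurable_continuous_on_indicator[of "{s k..t k}" "\<lambda>x. norm (\<gamma>' x)"]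
      continuous_on_subset[OF \<gamma>(2) sub[OF that]] by (simp add: h_def[abs_def] continuous_on_norm)
  have piece: "ennreal (c k) \<le> (\<integral>\<^sup>+ x. ennreal (B k) * ennreal (h k x) \<partial>lborel)" if k: "k \<ge> k0" for k
  proof -
    have "r2 k - r1 k \<le> norm (\<gamma> (t k) - \<gamma> (s k))"
      using norm_triangle_ineq2[of "\<gamma> (t k)" "\<gamma> (s k)"] st(4,5)[OF k] by simp
    then have "B k * (r2 k - r1 k) \<le> B k * norm (\<gamma> (t k) - \<gamma> (s k))" using B by (intro mult_left_mono) auto
    then have "c k \<le> B k * norm (\<gamma> (t k) - \<gamma> (s k))" using c(2)[of k] by linarith
    then have "ennreal (c k) \<le> ennreal (B k) * ennreal (norm (\<gamma> (t k) - \<gamma> (s k)))"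
      using B by (subst ennreal_mult[symmetric]) (auto intro: ennreal_leI)
    also have "\<dots> \<le> ennreal (B k) * (\<integral>\<^sup>+ x. ennreal (h k x) \<partial>lborel)"
      unfolding h_def
    proof (intro mult_left_mono chord_le_nn_integral)
      show "s k \<le> t k" using st(2)[OF k] by simp
      show "continuous_on {s k..t k} \<gamma>'" by (rule continuous_on_subset[OF \<gamma>(2) sub[OF k]])
      show "(\<gamma> has_vector_derivative \<gamma>' x) (at x within {s k..t k})" if "x \<in> {s k..t k}" for x
        using sub[OF k] that by (intro has_vector_derivative_within_subset[OF \<gamma>(1)]) auto
    qed simp
    also have "\<dots> = (\<integral>\<^sup>+ x. ennreal (B k) * ennreal (h k x) \<partial>lborel)"
      by (rule nn_integral_cmult[symmetric, OF meas[OF k]])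
    finally show ?thesis .
  qed
  \<comment> \<open>At each time at most one summand is nonzero, so every finite sum of crossing
    densities lies below the full integrand, and monotonicity of the nonnegative integral
    applies.\<close>
  have pointwise: "(\<Sum>k\<in>{k0..<k0+n}. ennreal (B k) * ennreal (h k x)) \<le> ennreal (indicator {0..<1} x * (l (\<gamma> x) * norm (\<gamma>' x)))" for n x
  proof (cases "\<exists>k\<in>{k0..<k0+n}. x \<in> {s k..t k}")
    case False
    then have "h k x = 0" if "k \<in> {k0..<k0+n}" for k using that by (auto simp: h_def)
    then have "(\<Sum>k\<in>{k0..<k0+n}. ennreal (B k) * ennreal (h k x)) = 0" by (intro sum.neutral) simp
    then show ?thesis by (simp only: zero_le)
  next
    case True
    then obtain k where k: "k \<in> {k0..<k0+n}" "x \<in> {s k..t k}" by blast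
    have "h j x = 0" if "j \<in> {k0..<k0+n} - {k}" for j
      using disj[of j k x] that k by (auto simp: h_def indicator_def)
    then have "(\<Sum>j\<in>{k0..<k0+n}. ennreal (B j) * ennreal (h j x)) = ennreal (B k) * ennreal (h k x)"
      using k(1) by (subst sum.remove[of _ k]) (auto intro!: sum.neutral)
    also have "\<dots> = ennreal (B k * norm (\<gamma>' x))"
      using k B by (simp add: h_def ennreal_mult)
    also have "\<dots> \<le> ennreal (l (\<gamma> x) * norm (\<gamma>' x))"
      using B(2) st(6,7)[of k x] k by (intro ennreal_leI mult_right_mono) auto
    also have "\<dots> = ennreal (indicator {0..<1} x * (l (\<gamma> x) * norm (\<gamma>' x)))"
      using sub[of k] k by (auto simp: indicator_def)
    finally show ?thesis .
  qed
  have bound: "ennreal (\<Sum>i<n. c (i + k0)) \<le> ?I" for n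
  proof -
    have "ennreal (\<Sum>i<n. c (i + k0)) = ennreal (\<Sum>k\<in>{k0..<k0+n}. c k)"
      using sum.shift_bounds_nat_ivl[of c 0 k0 n] by (simp add: atLeast0LessThan add.commute)
    also have "\<dots> = (\<Sum>k\<in>{k0..<k0+n}. ennreal (c k))" using c by (simp add: sum_ennreal)
    also have "\<dots> \<le> (\<Sum>k\<in>{k0..<k0+n}. (\<integral>\<^sup>+ x. ennreal (B k) * ennreal (h k x) \<partial>lborel))"
      using piece by (intro sum_mono) auto
    also have "\<dots> = (\<integral>\<^sup>+ x. (\<Sum>k\<in>{k0..<k0+n}. ennreal (B k) * ennreal (h k x)) \<partial>lborel)"
      by (rule nn_integral_sum[symmetric]) (auto intro!: borel_measurable_times_ennreal meas[simplified])
    also have "\<dots> \<le> ?I" by (intro nn_integral_mono pointwise)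
    finally show ?thesis .
  qed
  show ?thesis
  proof (rule ccontr)
    assume "?I \<noteq> \<infinity>"
    then obtain R where R: "R \<ge> 0" "?I = ennreal R" by (cases ?I) auto
    have "(\<Sum>i<n. c (i + k0)) \<le> R" for n using bound[of n] R by simp
    then have "summable (\<lambda>i. c (i + k0))" using c by (intro summableI_nonneg_bounded[of _ R]) auto
    then show False using c(3) by simp
  qed
qed

section \<open>Limits of entire functions on the disk and maximum principles\<close>

lemma rapid_limit:
  fixes f f' :: "nat \<Rightarrow> complex \<Rightarrow> complex" and r :: "nat \<Rightarrow> real"
  assumes d: "\<And>n z. (f n has_field_derivative f' n z) (at z)"
    and r: "r \<longlonglongrightarrow> 1"
    and b: "\<And>n z. cmod z \<le> r n \<Longrightarrow> cmod (f (Suc n) z - f n z) \<le> (1/2) ^ n"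
  obtains g g' where "\<And>z. cmod z < 1 \<Longrightarrow> (\<lambda>n. f n z) \<longlonglongrightarrow> g z"
    "\<And>z. cmod z < 1 \<Longrightarrow> (g has_field_derivative g' z) (at z)"
    "\<And>z. cmod z < 1 \<Longrightarrow> (\<lambda>n. f' n z) \<longlonglongrightarrow> g' z"
proof -
  \<comment> \<open>The limit is written as a telescoping series. For \<open>R < 1\<close> the radii
    \<open>r n\<close> eventually exceed \<open>R\<close>, so the M-test applies on each smaller
    disk, and uniform convergence there passes to derivatives.\<close>
  define g where "g z = f 0 z + (\<Sum>n. f (Suc n) z - f n z)" for z
  have ul: "uniform_limit (cball 0 R) f g sequentially" if "R < 1" for R
  proof -
    have "uniform_limit (cball 0 R) (\<lambda>n z. \<Sum>i<n. f (Suc i) z - f i z) (\<lambda>z. \<Sum>i. f (Suc i) z - f i z) sequentially"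
    proof (rule Weierstrass_m_test_ev[where M="\<lambda>n. (1/2) ^ n"])
      show "\<forall>\<^sub>F n in sequentially. \<forall>x\<in>cball 0 R. norm (f (Suc n) x - f n x) \<le> (1/2) ^ n"
        using order_tendstoD(1)[OF r that] by eventually_elim (auto intro: b)
      show "summable (\<lambda>n. (1/2::real) ^ n)" by (rule summable_geometric) simp
    qed
    then have "uniform_limit (cball 0 R) (\<lambda>n z. f 0 z + (\<Sum>i<n. f (Suc i) z - f i z)) g sequentially"
      unfolding g_def by (intro uniform_limit_intros)
    moreover have "f 0 z + (\<Sum>i<n. f (Suc i) z - f i z) = f n z" for n z
      by (subst sum_lessThan_telescope) simp
    ultimately show ?thesis by simp
  qed
  have "\<exists>g'. \<forall>x\<in>ball 0 1. (g has_field_derivative g' x) (at x) \<and> ((\<lambda>n. f' n x) \<longlongrightarrow> g' x) sequentially"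
  proof (rule has_complex_derivative_uniform_sequence)
    show "open (ball (0::complex) 1)" by simp
    show "(f n has_field_derivative f' n x) (at x)" for n x by (rule d)
    fix x :: complex assume x: "x \<in> ball 0 1"
    define e where "e = (1 - cmod x) / 2"
    have "cball x e \<subseteq> cball 0 (cmod x + e)" by (simp add: cball_subset_cball_iff)
    moreover have "cmod x + e < 1" "e > 0" using x by (auto simp: e_def field_simps)
    moreover have "cball (0::complex) (cmod x + e) \<subseteq> ball 0 1" using \<open>cmod x + e < 1\<close> by auto
    ultimately show "\<exists>d>0. cball x d \<subseteq> ball 0 1 \<and> uniform_limit (cball x d) f g sequentially"
      using uniform_limit_on_subset[OF ul[of "cmod x + e"], of "cball x e"] by blast
  qed
  then obtain g' where "\<forall>x\<in>ball 0 1. (g has_field_derivative g' x) (at x) \<and> (\<lambda>n. f' n x) \<longlonglongrightarrow> g' x" ..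
  then have g': "\<And>x. cmod x < 1 \<Longrightarrow> (g has_field_derivative g' x) (at x)" "\<And>x. cmod x < 1 \<Longrightarrow> (\<lambda>n. f' n x) \<longlonglongrightarrow> g' x"
    by auto
  have "(\<lambda>n. f n z) \<longlonglongrightarrow> g z" if "cmod z < 1" for z
    using tendsto_uniform_limitI[OF ul[OF that], of z] by simp
  then show thesis using g' that by blast
qed

text \<open>Maximum modulus for \<open>exp (poly p z)\<close>, whose norm is
  \<open>exp (Re (poly p z))\<close>.\<close>

lemma poly_Re_maximum_principle:
  fixes p :: "complex poly"
  assumes "\<And>z. cmod z = 1 \<Longrightarrow> Re (poly p z) \<le> c" "cmod z \<le> 1"
  shows "Re (poly p z) \<le> c"
proof -
  have "norm (exp (poly p z)) \<le> exp c"
  proof (rule maximum_modulus_frontier[where S="cball 0 1" and f="\<lambda>z. exp (poly p z)"])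
    show "(\<lambda>z. exp (poly p z)) holomorphic_on interior (cball 0 1)" by (intro holomorphic_intros)
    show "continuous_on (closure (cball 0 1)) (\<lambda>z. exp (poly p z))" by (intro continuous_intros)
  qed (use assms in \<open>auto simp: frontier_cball\<close>)
  then show ?thesis by simp
qed

lemma poly_abs_Re_maximum_principle:
  fixes p :: "complex poly"
  assumes "\<And>z. cmod z = 1 \<Longrightarrow> \<bar>Re (poly p z)\<bar> \<le> c" "cmod z \<le> 1"
  shows "\<bar>Re (poly p z)\<bar> \<le> c"
proof -
  have "Re (poly p w) \<le> c" "Re (poly (- p) w) \<le> c" if "cmod w = 1" for w
    using assms(1)[OF that] by (simp_all add: abs_le_iff)
  then have "Re (poly p z) \<le> c" "Re (poly (- p) z) \<le> c"
    using assms(2) by (blast intro: poly_Re_maximum_principle)+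
  then show ?thesis by (simp add: abs_le_iff)
qed

lemma poly_maximum_modulus:
  fixes p :: "complex poly"
  assumes "\<And>z. cmod z = 1 \<Longrightarrow> cmod (poly p z) \<le> c" "cmod z \<le> 1"
  shows "cmod (poly p z) \<le> c"
proof (rule maximum_modulus_frontier[where S="cball 0 1" and f="poly p"])
  show "poly p holomorphic_on interior (cball 0 1)" by (intro holomorphic_intros)
  show "continuous_on (closure (cball 0 1)) (poly p)" by (intro continuous_intros)
qed (use assms in \<open>auto simp: frontier_cball\<close>)

section \<open>The complete curve in the tube\<close>

text \<open>Iterates \<open>tube_curve_step\<close> with a budget: the total change of
  \<open>tube\<close> on the circle is bounded by a telescoping sum, so every stage satisfies the
  hypotheses of the next one.\<close>

lemma tube_curve_sequence:
  obtains \<delta> q \<alpha> :: "nat \<Rightarrow> complex poly" and r r1 r2 B :: "nat \<Rightarrow> real" where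
    "\<And>n. pderiv (\<delta> n) = (q n - 1) * pderiv (\<alpha> n)" "\<And>n. coeff (q n) 1 = 1/100"
    "\<And>n z. cmod z = 1 \<Longrightarrow> tube (poly (\<alpha> n) z) (poly (q n) z) (poly (\<delta> n) z) \<le> 1/4"
    "r \<longlonglongrightarrow> 1"
    "\<And>n. r n < r1 n" "\<And>n. r1 n < r2 n" "\<And>n. r2 n \<le> r (Suc n)" "\<And>n. r n < 1"
    "\<And>n. 0 < B n" "\<And>n. 1 / (32768 * (real n + 1)) \<le> B n * (r2 n - r1 n)"
    "\<And>n z. r1 n \<le> cmod z \<Longrightarrow> cmod z \<le> r2 n \<Longrightarrow>
       B n + 3 \<le> cmod (poly (pderiv (\<alpha> (Suc n))) z) + cmod (poly (pderiv (q (Suc n))) z)"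
    "\<And>n z. cmod z \<le> r n \<Longrightarrow> cmod (poly (\<alpha> (Suc n)) z - poly (\<alpha> n) z) \<le> (1/2) ^ Suc n"
    "\<And>n z. cmod z \<le> r n \<Longrightarrow> cmod (poly (q (Suc n)) z - poly (q n) z) \<le> (1/2) ^ Suc n"
    "\<And>n z. cmod z \<le> r n \<Longrightarrow> cmod (poly (\<delta> (Suc n)) z - poly (\<delta> n) z) \<le> (1/2) ^ Suc n"
    "\<And>n z. cmod z \<le> r n \<Longrightarrow> cmod (poly (pderiv (\<alpha> (Suc n))) z - poly (pderiv (\<alpha> n)) z) \<le> (1/2) ^ Suc n"
    "\<And>n z. cmod z \<le> r n \<Longrightarrow> cmod (poly (pderiv (q (Suc n))) z - poly (pderiv (q n)) z) \<le> (1/2) ^ Suc n"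
proof -
  \<comment> \<open>Invariant of stage \<open>n\<close>. The margins
    \<open>1 / (128 * (real n + 1))\<close> are the unspent budget and never reach zero; the lower
    bound on \<open>r\<close> drives the radii to 1. The relation \<open>A\<close> below records
    what one step achieves.\<close>
  define G :: "nat \<Rightarrow> complex poly \<times> complex poly \<times> complex poly \<times> real \<Rightarrow> bool" where
    "G = (\<lambda>n (\<alpha>, q, \<delta>, r). pderiv \<delta> = (q - 1) * pderiv \<alpha> \<and> coeff q 1 = 1/100 \<and>
      1 - 1 / (real n + 1) \<le> r \<and> r < 1 \<and>
      (\<forall>z. cmod z = 1 \<longrightarrow> 1/32 + 1 / (128 * (real n + 1)) \<le> tube (poly \<alpha> z) (poly q z) (poly \<delta> z) \<and>
        tube (poly \<alpha> z) (poly q z) (poly \<delta> z) \<le> 1/4 - 1 / (128 * (real n + 1))))"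
  define A :: "nat \<Rightarrow> complex poly \<times> complex poly \<times> complex poly \<times> real \<Rightarrow> complex poly \<times> complex poly \<times> complex poly \<times> real \<Rightarrow> real \<Rightarrow> real \<Rightarrow> real \<Rightarrow> bool" where
    "A = (\<lambda>n (\<alpha>, q, \<delta>, r) (\<alpha>', q', \<delta>', r') r1 r2 B. r < r1 \<and> r1 < r2 \<and> r2 \<le> r' \<and> 0 < B \<and>
      1 / (32768 * (real n + 1)) \<le> B * (r2 - r1) \<and>
      (\<forall>z. r1 \<le> cmod z \<longrightarrow> cmod z \<le> r2 \<longrightarrow> B + 3 \<le> cmod (poly (pderiv \<alpha>') z) + cmod (poly (pderiv q') z)) \<and>
      (\<forall>z. cmod z \<le> r \<longrightarrow> cmod (poly \<alpha>' z - poly \<alpha> z) \<le> (1/2) ^ Suc n \<and>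
         cmod (poly q' z - poly q z) \<le> (1/2) ^ Suc n \<and> cmod (poly \<delta>' z - poly \<delta> z) \<le> (1/2) ^ Suc n \<and>
         cmod (poly (pderiv \<alpha>') z - poly (pderiv \<alpha>) z) \<le> (1/2) ^ Suc n \<and>
         cmod (poly (pderiv q') z - poly (pderiv q) z) \<le> (1/2) ^ Suc n))"
  have "\<exists>S. \<forall>n. G n (S n) \<and> (\<exists>r1 r2 B. A n (S n) (S (Suc n)) r1 r2 B)"
  proof (rule dependent_nat_choice)
    \<comment> \<open>The initial curve is \<open>\<alpha> = 0\<close>, \<open>\<delta> = 0\<close>,
      \<open>q = 1/4 + z/100\<close>: its tube value is close to 1/16, well between the two limits,
      and its linear coefficient is nonzero.\<close>
    have "1/32 + 1/128 \<le> (cmod (1/4 + z / 100))\<^sup>2 \<and> (cmod (1/4 + z / 100))\<^sup>2 \<le> 1/4 - 1/128" if "cmod z = 1" for z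
    proof -
      have n: "cmod (z / 100) = 1/100" using that by (simp add: norm_divide)
      have "1/4 - 1/100 \<le> cmod (1/4 + z/100)" "cmod (1/4 + z/100) \<le> 1/4 + 1/100"
        using norm_diff_ineq[of "1/4" "z/100"] norm_triangle_ineq[of "1/4" "z/100"] n by auto
      then have "(1/4 - 1/100)\<^sup>2 \<le> (cmod (1/4 + z / 100))\<^sup>2" "(cmod (1/4 + z / 100))\<^sup>2 \<le> (1/4 + 1/100)\<^sup>2"
        by (intro power_mono; simp)+
      then show ?thesis by (simp add: power2_eq_square)
    qed
    then have "G 0 (0, [:1/4, 1/100:], 0, 0)"
      by (simp add: G_def tube_def)
    then show "\<exists>x. G 0 x" ..
  next
    fix x n assume "G n x"
    moreover obtain \<alpha> q \<delta> r where x: "x = (\<alpha>, q, \<delta>, r)" by (cases x)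
    ultimately have rel: "pderiv \<delta> = (q - 1) * pderiv \<alpha>" and co: "coeff q 1 = 1/100"
      and r: "1 - 1 / (real n + 1) \<le> r" "r < 1"
      and t: "\<And>z. cmod z = 1 \<Longrightarrow> 1/32 + 1 / (128 * (real n + 1)) \<le> tube (poly \<alpha> z) (poly q z) (poly \<delta> z)"
        "\<And>z. cmod z = 1 \<Longrightarrow> tube (poly \<alpha> z) (poly q z) (poly \<delta> z) \<le> 1/4 - 1 / (128 * (real n + 1))"
      by (auto simp: G_def)
    have pos: "0 < 1 / (128 * (real n + 1))" by simp
    have t1: "1/32 \<le> tube (poly \<alpha> z) (poly q z) (poly \<delta> z)" if "cmod z = 1" for z using t(1)[OF that] pos by linarith
    have t2: "tube (poly \<alpha> z) (poly q z) (poly \<delta> z) \<le> 1/4" if "cmod z = 1" for z using t(2)[OF that] pos by linarith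
    have telescope: "1 / (128 * (x * (x + 1))) = 1 / (128 * x) - 1 / (128 * (x + 1))" if "x > 0" for x :: real
      using that by (simp add: field_simps)
    \<comment> \<open>The step sizes have divergent sum, which gives completeness, but summable squares, which keeps
      the curve in the tube.\<close>
    define a where "a = 1 / (64 * (real n + 1))"
    have a: "0 < a" "a \<le> 1" by (auto simp: a_def field_simps)
    have a512: "a / 512 = 1 / (32768 * (real n + 1))" by (simp add: a_def)
    \<comment> \<open>The cost of this step is at most the amount by which the margin shrinks, since
      \<open>n + 2 \<le> 2 * (n + 1)\<close>.\<close>
    have "16 * a\<^sup>2 = 1 / (256 * ((real n + 1) * (real n + 1)))" 
      unfolding a_def power_divide power_mult_distrib by (simp add: power2_eq_square)
    also have "\<dots> \<le> 1 / (128 * ((real n + 1) * (real n + 2)))"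
    proof (rule divide_left_mono)
      have "(real n + 1) * (real n + 2) \<le> (real n + 1) * (2 * (real n + 1))" by (intro mult_left_mono) auto
      then show "128 * ((real n + 1) * (real n + 2)) \<le> 256 * ((real n + 1) * (real n + 1))" by simp
    qed auto
    also have "\<dots> = 1 / (128 * (real n + 1)) - 1 / (128 * (real (Suc n) + 1))"
      using telescope[of "real n + 1"] by (simp add: add.assoc)
    finally have a2: "16 * a\<^sup>2 \<le> 1 / (128 * (real n + 1)) - 1 / (128 * (real (Suc n) + 1))" .
    have e: "0 < (1/2::real) ^ Suc n" by simp
    obtain \<alpha>' q' \<delta>' r1 r2 B where st: "pderiv \<delta>' = (q' - 1) * pderiv \<alpha>'"
        "\<And>z. cmod z = 1 \<Longrightarrow> \<bar>tube (poly \<alpha>' z) (poly q' z) (poly \<delta>' z) - tube (poly \<alpha> z) (poly q z) (poly \<delta> z)\<bar> \<le> 16 * a\<^sup>2"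
        "coeff q' 1 = coeff q 1"
        "\<And>z. cmod z \<le> r \<Longrightarrow> cmod (poly \<alpha>' z - poly \<alpha> z) \<le> (1/2) ^ Suc n"
        "\<And>z. cmod z \<le> r \<Longrightarrow> cmod (poly q' z - poly q z) \<le> (1/2) ^ Suc n"
        "\<And>z. cmod z \<le> r \<Longrightarrow> cmod (poly \<delta>' z - poly \<delta> z) \<le> (1/2) ^ Suc n"
        "\<And>z. cmod z \<le> r \<Longrightarrow> cmod (poly (pderiv \<alpha>') z - poly (pderiv \<alpha>) z) \<le> (1/2) ^ Suc n"
        "\<And>z. cmod z \<le> r \<Longrightarrow> cmod (poly (pderiv q') z - poly (pderiv q) z) \<le> (1/2) ^ Suc n"
        "r < r1" "r1 < r2" "r2 < 1" "0 < B" "a / 512 \<le> B * (r2 - r1)"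
        "\<And>z. r1 \<le> cmod z \<Longrightarrow> cmod z \<le> r2 \<Longrightarrow> B + 3 \<le> cmod (poly (pderiv \<alpha>') z) + cmod (poly (pderiv q') z)"
    proof (rule tube_curve_step[OF rel _ _ a r(2) e], goal_cases)
      case 1
      show ?case by (rule t1) (fact 1)
    next
      case 2
      show ?case by (rule t2) (fact 2)
    next
      case 3
      show ?case by (rule that) (fact 3)+
    qed
    define r' where "r' = max r2 (1 - 1 / (real (Suc n) + 1))"
    have "G (Suc n) (\<alpha>', q', \<delta>', r')"
      unfolding G_def prod.case
    proof (intro conjI allI impI)
      show "pderiv \<delta>' = (q' - 1) * pderiv \<alpha>'" by (rule st)
      show "coeff q' 1 = 1/100" using st(3) co by simp
      show "1 - 1 / (real (Suc n) + 1) \<le> r'" "r' < 1" using st(11) by (auto simp: r'_def)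
      fix z :: complex assume z: "cmod z = 1"
      show "1/32 + 1 / (128 * (real (Suc n) + 1)) \<le> tube (poly \<alpha>' z) (poly q' z) (poly \<delta>' z)"
        "tube (poly \<alpha>' z) (poly q' z) (poly \<delta>' z) \<le> 1/4 - 1 / (128 * (real (Suc n) + 1))"
        using st(2)[OF z] t[OF z] a2 by linarith+
    qed
    moreover have "A n x (\<alpha>', q', \<delta>', r') r1 r2 B"
      unfolding A_def x prod.case using st(4-14) a512 by (auto simp: r'_def)
    ultimately show "\<exists>y. G (Suc n) y \<and> (\<exists>r1 r2 B. A n x y r1 r2 B)" by blast
  qed
  then obtain S where S: "\<And>n. G n (S n)" "\<And>n. \<exists>r1 r2 B. A n (S n) (S (Suc n)) r1 r2 B" by blast
  then obtain r1 r2 B where A: "\<And>n. A n (S n) (S (Suc n)) (r1 n) (r2 n) (B n)" by metis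
  define \<alpha> where "\<alpha> n = fst (S n)" for n
  define q where "q n = fst (snd (S n))" for n
  define \<delta> where "\<delta> n = fst (snd (snd (S n)))" for n
  define r where "r n = snd (snd (snd (S n)))" for n
  have S_eq: "S n = (\<alpha> n, q n, \<delta> n, r n)" for n by (simp add: \<alpha>_def q_def \<delta>_def r_def)
  note G' = S(1)[unfolded S_eq G_def prod.case] and A' = A[unfolded S_eq A_def prod.case]
  have "(\<lambda>n. 1 - 1 / (real n + 1)) \<longlonglongrightarrow> 1" by real_asymp
  then have "r \<longlonglongrightarrow> 1"
    by (rule tendsto_sandwich[rotated 2]) (use G' in \<open>auto intro!: always_eventually less_imp_le\<close>)
  moreover have "tube (poly (\<alpha> n) z) (poly (q n) z) (poly (\<delta> n) z) \<le> 1/4" if "cmod z = 1" for n z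
  proof -
    have "tube (poly (\<alpha> n) z) (poly (q n) z) (poly (\<delta> n) z) \<le> 1/4 - 1 / (128 * (real n + 1))"
      using G'[of n] that by blast
    moreover have "0 < 1 / (128 * (real n + 1))" by simp
    ultimately show ?thesis by linarith
  qed
  ultimately show thesis
    using G' A' by (intro that[of \<delta> q \<alpha> r r1 r2 B]) simp_all
qed

section \<open>Passage to the limit curve\<close>

lemma geometric_limit_bound:
  fixes f :: "nat \<Rightarrow> complex"
  assumes "\<And>i. i \<ge> j \<Longrightarrow> cmod (f (Suc i) - f i) \<le> (1/2) ^ Suc i" "f \<longlonglongrightarrow> g"
  shows "cmod (g - f j) \<le> (1/2) ^ j"
proof -
  \<comment> \<open>Subtracting \<open>(1/2) ^ n\<close> keeps the exact partial geometric sum,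
    which makes the induction close.\<close>
  have "cmod (f n - f j) \<le> (1/2) ^ j - (1/2) ^ n" if "n \<ge> j" for n
    using that
  proof (induction n rule: dec_induct)
    case (step n)
    then show ?case
      using norm_triangle_ineq[of "f (Suc n) - f n" "f n - f j"] assms(1)[of n] by simp
  qed simp
  then have "\<forall>n\<ge>j. cmod (f n - f j) \<le> (1/2) ^ j"
    by (meson diff_le_eq le_add_same_cancel1 order_trans zero_le_power zero_le_divide_1_iff zero_le_numeral)
  then show ?thesis
    using assms(2) by (intro Lim_bounded[of "\<lambda>n. cmod (f n - f j)"]) (auto intro!: tendsto_intros)
qed

text \<open>The tube bound is known on the circle only; splitting it into bounds on
  \<open>Im \<alpha>\<close>, \<open>q\<close> and \<open>Re \<delta>\<close> lets the maximum
  principle bring each into the disk before taking limits. The derivative bounds on the annuli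
  survive with a loss of at most 1.\<close>

lemma bounded_tube_curve:
  obtains \<alpha> \<alpha>' q q' \<delta> :: "complex \<Rightarrow> complex" and r1 r2 B :: "nat \<Rightarrow> real" where
    "\<And>z. cmod z < 1 \<Longrightarrow> (\<alpha> has_field_derivative \<alpha>' z) (at z)"
    "\<And>z. cmod z < 1 \<Longrightarrow> (q has_field_derivative q' z) (at z)"
    "\<And>z. cmod z < 1 \<Longrightarrow> (\<delta> has_field_derivative (q z - 1) * \<alpha>' z) (at z)"
    "\<And>z. cmod z < 1 \<Longrightarrow> \<bar>Im (\<alpha> z)\<bar> \<le> 1/2" "\<And>z. cmod z < 1 \<Longrightarrow> cmod (q z) \<le> 1/2"
    "\<And>z. cmod z < 1 \<Longrightarrow> \<bar>Re (\<delta> z)\<bar> \<le> 1/2" "q' 0 \<noteq> 0"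
    "\<And>k. r1 k < r2 k" "\<And>k. r2 k < r1 (Suc k)" "\<And>k. r2 k < 1" "r1 \<longlonglongrightarrow> 1"
    "\<And>k. 0 < B k" "\<And>k. 1 / (32768 * (real k + 1)) \<le> B k * (r2 k - r1 k)"
    "\<And>k z. r1 k \<le> cmod z \<Longrightarrow> cmod z \<le> r2 k \<Longrightarrow> B k + 2 \<le> cmod (\<alpha>' z) + cmod (q' z)"
proof -
  obtain \<delta> q \<alpha> r r1 r2 B where rel: "\<And>n. pderiv (\<delta> n) = (q n - 1) * pderiv (\<alpha> n)"
    and co: "\<And>n. coeff (q n) 1 = 1/100"
    and t: "\<And>n z. cmod z = 1 \<Longrightarrow> tube (poly (\<alpha> n) z) (poly (q n) z) (poly (\<delta> n) z) \<le> 1/4"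
    and lim: "r \<longlonglongrightarrow> 1"
    and r: "\<And>n. r n < r1 n" "\<And>n. r1 n < r2 n" "\<And>n. r2 n \<le> r (Suc n)" "\<And>n. r n < 1"
    and B: "\<And>n. 0 < B n" "\<And>n. 1 / (32768 * (real n + 1)) \<le> B n * (r2 n - r1 n)"
      "\<And>n z. r1 n \<le> cmod z \<Longrightarrow> cmod z \<le> r2 n \<Longrightarrow>
       B n + 3 \<le> cmod (poly (pderiv (\<alpha> (Suc n))) z) + cmod (poly (pderiv (q (Suc n))) z)"
    and d: "\<And>n z. cmod z \<le> r n \<Longrightarrow> cmod (poly (\<alpha> (Suc n)) z - poly (\<alpha> n) z) \<le> (1/2) ^ Suc n"
    "\<And>n z. cmod z \<le> r n \<Longrightarrow> cmod (poly (q (Suc n)) z - poly (q n) z) \<le> (1/2) ^ Suc n"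
    "\<And>n z. cmod z \<le> r n \<Longrightarrow> cmod (poly (\<delta> (Suc n)) z - poly (\<delta> n) z) \<le> (1/2) ^ Suc n"
    "\<And>n z. cmod z \<le> r n \<Longrightarrow> cmod (poly (pderiv (\<alpha> (Suc n))) z - poly (pderiv (\<alpha> n)) z) \<le> (1/2) ^ Suc n"
    "\<And>n z. cmod z \<le> r n \<Longrightarrow> cmod (poly (pderiv (q (Suc n))) z - poly (pderiv (q n)) z) \<le> (1/2) ^ Suc n"
  proof (rule tube_curve_sequence, goal_cases)
    case 1
    show ?case by (rule that) (fact 1)+
  qed
  have le: "(1/2::real) ^ Suc n \<le> (1/2) ^ n" for n by simp
  obtain a a' where a: "\<And>z. cmod z < 1 \<Longrightarrow> (\<lambda>n. poly (\<alpha> n) z) \<longlonglongrightarrow> a z"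
    "\<And>z. cmod z < 1 \<Longrightarrow> (a has_field_derivative a' z) (at z)"
    "\<And>z. cmod z < 1 \<Longrightarrow> (\<lambda>n. poly (pderiv (\<alpha> n)) z) \<longlonglongrightarrow> a' z"
    using rapid_limit[where f="\<lambda>n. poly (\<alpha> n)" and f'="\<lambda>n. poly (pderiv (\<alpha> n))", OF poly_DERIV lim order_trans[OF d(1) le]] by metis
  obtain p p' where p: "\<And>z. cmod z < 1 \<Longrightarrow> (\<lambda>n. poly (q n) z) \<longlonglongrightarrow> p z"
    "\<And>z. cmod z < 1 \<Longrightarrow> (p has_field_derivative p' z) (at z)"
    "\<And>z. cmod z < 1 \<Longrightarrow> (\<lambda>n. poly (pderiv (q n)) z) \<longlonglongrightarrow> p' z"
    using rapid_limit[where f="\<lambda>n. poly (q n)" and f'="\<lambda>n. poly (pderiv (q n))", OF poly_DERIV lim order_trans[OF d(2) le]] by metis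
  obtain e e' where e: "\<And>z. cmod z < 1 \<Longrightarrow> (\<lambda>n. poly (\<delta> n) z) \<longlonglongrightarrow> e z"
    "\<And>z. cmod z < 1 \<Longrightarrow> (e has_field_derivative e' z) (at z)"
    "\<And>z. cmod z < 1 \<Longrightarrow> (\<lambda>n. poly (pderiv (\<delta> n)) z) \<longlonglongrightarrow> e' z"
    using rapid_limit[where f="\<lambda>n. poly (\<delta> n)" and f'="\<lambda>n. poly (pderiv (\<delta> n))", OF poly_DERIV lim order_trans[OF d(3) le]] by metis
  have e': "e' z = (p z - 1) * a' z" if z: "cmod z < 1" for z
  proof -
    have "(\<lambda>n. (poly (q n) z - 1) * poly (pderiv (\<alpha> n)) z) \<longlonglongrightarrow> (p z - 1) * a' z"
      by (intro tendsto_intros p(1)[OF z] a(3)[OF z])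
    moreover have "(\<lambda>n. (poly (q n) z - 1) * poly (pderiv (\<alpha> n)) z) \<longlonglongrightarrow> e' z"
      using e(3)[OF z] by (simp add: rel)
    ultimately show ?thesis using LIMSEQ_unique by blast
  qed
  have tb: "\<bar>Im (poly (\<alpha> n) z)\<bar> \<le> 1/2" "cmod (poly (q n) z) \<le> 1/2" "\<bar>Re (poly (\<delta> n) z)\<bar> \<le> 1/2"
    if "cmod z = 1" for n z using tube_bounds[OF t[OF that, of n]] by auto
  \<comment> \<open>\<open>Im \<alpha>\<close> is the real part of
    \<open>-\<i> * \<alpha>\<close>.\<close>
  have b1: "\<bar>Im (poly (\<alpha> n) z)\<bar> \<le> 1/2" if z: "cmod z < 1" for n z
    using poly_abs_Re_maximum_principle[of "smult (-\<i>) (\<alpha> n)" "1/2" z] tb(1) z by simp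
  have b2: "cmod (poly (q n) z) \<le> 1/2" if z: "cmod z < 1" for n z
    using poly_maximum_modulus[OF tb(2)] z by simp
  have b3: "\<bar>Re (poly (\<delta> n) z)\<bar> \<le> 1/2" if z: "cmod z < 1" for n z
    using poly_abs_Re_maximum_principle[OF tb(3)] z by simp
  have r_mono: "r i \<le> r j" if "i \<le> j" for i j
  proof (rule lift_Suc_mono_le[of r, OF _ that])
    show "r n \<le> r (Suc n)" for n using r(1)[of n] r(2)[of n] r(3)[of n] by linarith
  qed
  show thesis
  proof (rule that[of a a' p p' e r1 r2 B])
    show "(a has_field_derivative a' z) (at z)" "(p has_field_derivative p' z) (at z)"
      "(e has_field_derivative (p z - 1) * a' z) (at z)" if "cmod z < 1" for z
      using a(2) p(2) e(2) e' that by auto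
    show "\<bar>Im (a z)\<bar> \<le> 1/2" if "cmod z < 1" for z
      using b1[OF that] by (intro Lim_bounded[OF tendsto_rabs[OF tendsto_Im[OF a(1)[OF that]]], of 0]) auto
    show "cmod (p z) \<le> 1/2" if "cmod z < 1" for z
      using b2[OF that] by (intro Lim_bounded[OF tendsto_norm[OF p(1)[OF that]], of 0]) auto
    show "\<bar>Re (e z)\<bar> \<le> 1/2" if "cmod z < 1" for z
      using b3[OF that] by (intro Lim_bounded[OF tendsto_rabs[OF tendsto_Re[OF e(1)[OF that]]], of 0]) auto
    have "(\<lambda>n. poly (pderiv (q n)) 0) = (\<lambda>n. 1/100)"
      by (rule ext) (use co in \<open>simp add: poly_0_coeff_0 coeff_pderiv\<close>)
    then have "(\<lambda>n::nat. 1/100) \<longlonglongrightarrow> p' 0" using p(3)[of 0] by (simp only: norm_zero zero_less_one)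
    then have "p' 0 = 1/100" by (simp only: LIMSEQ_const_iff)
    then show "p' 0 \<noteq> 0" by auto
    show "r1 k < r2 k" "0 < B k" "1 / (32768 * (real k + 1)) \<le> B k * (r2 k - r1 k)" for k
      using r B by auto
    show "r2 k < r1 (Suc k)" "r2 k < 1" for k
      using r(3)[of k] r(1)[of "Suc k"] r(4)[of "Suc k"] by linarith+
    show "r1 \<longlonglongrightarrow> 1"
    proof (rule tendsto_sandwich[OF _ _ lim])
      show "\<forall>\<^sub>F n in sequentially. r n \<le> r1 n" using r(1) by (auto intro!: always_eventually less_imp_le)
      have "r1 n \<le> 1" for n using r(2)[of n] r(3)[of n] r(4)[of "Suc n"] by linarith
      then show "\<forall>\<^sub>F n in sequentially. r1 n \<le> 1" by simp
    qed simp
    fix k z assume z: "r1 k \<le> cmod z" "cmod z \<le> r2 k"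
    \<comment> \<open>Every stage from \<open>Suc k\<close> on is controlled at \<open>z\<close>, so
      the limit of each derivative differs from stage \<open>Suc k\<close> by at most
      \<open>(1/2) ^ Suc k\<close>, hence by at most 1/2.\<close>
    have zr: "cmod z \<le> r i" if "i \<ge> Suc k" for i using r_mono[OF that] r(3)[of k] z by linarith
    then have z1: "cmod z < 1" using r(4)[of "Suc k"] by force
    have half: "(1/2::real) ^ Suc k \<le> 1/2" using power_le_one[of "1/2::real" k] by simp
    have "cmod (a' z - poly (pderiv (\<alpha> (Suc k))) z) \<le> (1/2) ^ Suc k"
      using zr d(4) by (intro geometric_limit_bound[OF _ a(3)[OF z1]]) auto
    moreover have "cmod (p' z - poly (pderiv (q (Suc k))) z) \<le> (1/2) ^ Suc k"
      using zr d(5) by (intro geometric_limit_bound[OF _ p(3)[OF z1]]) auto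
    ultimately show "B k + 2 \<le> cmod (a' z) + cmod (p' z)"
      using B(3)[OF z] half norm_triangle_ineq3[of "a' z" "poly (pderiv (\<alpha> (Suc k))) z"]
        norm_triangle_ineq3[of "p' z" "poly (pderiv (q (Suc k))) z"] by linarith
  qed
qed

section \<open>Removing common zeros of the derivatives\<close>

lemma holomorphic_on_unit_ballI:
  assumes "\<And>z. cmod z < 1 \<Longrightarrow> (f has_field_derivative f' z) (at z)"
  shows "f holomorphic_on ball 0 1"
  unfolding holomorphic_on_open[OF open_ball] using assms by (metis mem_ball_0)

text \<open>Away from the annuli \<open>\<alpha>'\<close> and \<open>q'\<close> of the limit could
  vanish together, making the metric degenerate. A small linear perturbation of
  \<open>\<alpha>\<close>, with the matching correction of \<open>\<delta>\<close>, prevents this at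
  the price of slightly weaker bounds.\<close>

lemma immersed_tube_curve:
  obtains \<alpha> \<alpha>' q q' \<delta> :: "complex \<Rightarrow> complex" and r1 r2 B :: "nat \<Rightarrow> real" where
    "\<And>z. cmod z < 1 \<Longrightarrow> (\<alpha> has_field_derivative \<alpha>' z) (at z)"
    "\<And>z. cmod z < 1 \<Longrightarrow> (q has_field_derivative q' z) (at z)"
    "\<And>z. cmod z < 1 \<Longrightarrow> (\<delta> has_field_derivative (q z - 1) * \<alpha>' z) (at z)"
    "\<And>z. cmod z < 1 \<Longrightarrow> \<bar>Im (\<alpha> z)\<bar> \<le> 1" "\<And>z. cmod z < 1 \<Longrightarrow> cmod (q z) \<le> 1/2"
    "\<And>z. cmod z < 1 \<Longrightarrow> \<bar>Re (\<delta> z)\<bar> \<le> 2" "\<And>z. cmod z < 1 \<Longrightarrow> 0 < cmod (\<alpha>' z) + cmod (q' z)"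
    "\<And>k. r1 k < r2 k" "\<And>k. r2 k < r1 (Suc k)" "\<And>k. r2 k < 1" "r1 \<longlonglongrightarrow> 1"
    "\<And>k. 0 < B k" "\<And>k. 1 / (32768 * (real k + 1)) \<le> B k * (r2 k - r1 k)"
    "\<And>k z. r1 k \<le> cmod z \<Longrightarrow> cmod z \<le> r2 k \<Longrightarrow> B k \<le> cmod (\<alpha>' z) + cmod (q' z)"
proof -
  obtain a a' q q' e r1 r2 B where
    a: "\<And>z. cmod z < 1 \<Longrightarrow> (a has_field_derivative a' z) (at z)"
    and q: "\<And>z. cmod z < 1 \<Longrightarrow> (q has_field_derivative q' z) (at z)"
    and e: "\<And>z. cmod z < 1 \<Longrightarrow> (e has_field_derivative (q z - 1) * a' z) (at z)"
    and b: "\<And>z. cmod z < 1 \<Longrightarrow> \<bar>Im (a z)\<bar> \<le> 1/2" "\<And>z. cmod z < 1 \<Longrightarrow> cmod (q z) \<le> 1/2"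
    "\<And>z. cmod z < 1 \<Longrightarrow> \<bar>Re (e z)\<bar> \<le> 1/2" and q0: "q' 0 \<noteq> 0"
    and r: "\<And>k. r1 k < r2 k" "\<And>k. r2 k < r1 (Suc k)" "\<And>k. r2 k < 1" "r1 \<longlonglongrightarrow> 1"
    and B: "\<And>k. 0 < B k" "\<And>k. 1 / (32768 * (real k + 1)) \<le> B k * (r2 k - r1 k)"
    "\<And>k z. r1 k \<le> cmod z \<Longrightarrow> cmod z \<le> r2 k \<Longrightarrow> B k + 2 \<le> cmod (a' z) + cmod (q' z)"
  proof (rule bounded_tube_curve, goal_cases)
    case 1
    show ?case by (rule that) (fact 1)+
  qed
  have qh: "q holomorphic_on ball 0 1"
    by (rule holomorphic_on_unit_ballI[OF q])
  have "deriv q holomorphic_on ball 0 1" using qh by (intro holomorphic_deriv) auto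
  moreover have dq: "deriv q z = q' z" if "cmod z < 1" for z by (rule DERIV_imp_deriv[OF q[OF that]])
  ultimately have q'h: "q' holomorphic_on ball 0 1" by (subst holomorphic_cong[of _ _ _ "deriv q"]) auto
  \<comment> \<open>Since \<open>q' 0 \<noteq> 0\<close>, \<open>q'\<close> does not vanish
    identically; the constant case is separated because the countability theorem for zeros concerns
    nonconstant functions.\<close>
  have count: "countable {z \<in> ball 0 1. q' z = 0}"
  proof (cases "q' constant_on ball 0 1")
    case True
    then obtain y where "\<And>z. z \<in> ball 0 1 \<Longrightarrow> q' z = y" unfolding constant_on_def by blast
    then have "q' z \<noteq> 0" if "z \<in> ball 0 1" for z using q0 that by (metis centre_in_ball zero_less_one)
    then have "{z \<in> ball 0 1. q' z = 0} = {}" by blast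
    then show ?thesis by (simp only: countable_empty)
  next
    case False
    obtain F :: "nat \<Rightarrow> complex set" where "\<And>n. compact (F n)" "\<Union> (range F) = ball 0 1"
      using open_Union_compact_subsets[OF open_ball] by metis
    then have "fsigma (ball (0::complex) 1)"
      using fsigma.intros[of F] compact_imp_closed by (metis image_subsetI mem_Collect_eq)
    then show ?thesis using q'h False by (intro holomorphic_countable_zeros) auto
  qed
  \<comment> \<open>Replacing \<open>\<alpha>\<close> by \<open>\<alpha> + \<eta> z\<close> removes the common zeros of the two derivatives for all but
    countably many \<open>\<eta>\<close>.\<close>
  then have "countable ((\<lambda>z. - Re (a' z)) ` {z \<in> ball 0 1. q' z = 0})" by (rule countable_image)
  then have "\<exists>\<eta>\<in>{0<..<1/2}. \<eta> \<notin> (\<lambda>z. - Re (a' z)) ` {z \<in> ball 0 1. q' z = 0}"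
    by (rule open_minus_countable) auto
  then obtain \<eta> :: real where \<eta>': "\<eta> \<in> {0<..<1/2}" "\<eta> \<notin> (\<lambda>z. - Re (a' z)) ` {z \<in> ball 0 1. q' z = 0}" ..
  have \<eta>: "0 < \<eta>" "\<eta> < 1/2" using \<eta>'(1) by auto
  \<comment> \<open>As \<open>\<eta>\<close> is real, it is enough that the real part of
    \<open>a' z + of_real \<eta>\<close> is nonzero wherever \<open>q' z = 0\<close>.\<close>
  have \<eta>0: "\<eta> \<noteq> - Re (a' z)" if "cmod z < 1" "q' z = 0" for z using \<eta>'(2) that by auto
  \<comment> \<open>Adding \<open>\<eta> z\<close> to \<open>\<alpha>\<close> changes
    \<open>d\<delta>\<close> by \<open>\<eta> (q - 1) dz\<close>, so \<open>\<delta>\<close> needs a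
    primitive of \<open>q - 1\<close>, normalised at 0 to be bounded by 3/2.\<close>
  obtain g where g0: "\<And>z. z \<in> ball 0 1 \<Longrightarrow> (g has_field_derivative q z - 1) (at z within ball 0 1)"
    using holomorphic_convex_primitive'[OF convex_ball open_ball holomorphic_on_diff[OF qh holomorphic_on_const]]
    by metis
  have g: "(g has_field_derivative q z - 1) (at z)" if "cmod z < 1" for z
  proof -
    have z: "z \<in> ball 0 1" using that by simp
    show ?thesis using g0[OF z] unfolding at_within_open[OF z open_ball] .
  qed
  have g_bound: "cmod (g z - g 0) \<le> 3/2" if "cmod z < 1" for z
  proof -
    have "cmod (g z - g 0) \<le> 3/2 * cmod (z - 0)"
    proof (rule field_differentiable_bound[of "ball 0 1"])
      fix w :: complex assume "w \<in> ball 0 1"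
      then have w: "cmod w < 1" by simp
      show "(g has_field_derivative q w - 1) (at w within ball 0 1)"
        using g[OF w] by (rule has_field_derivative_at_within)
      show "cmod (q w - 1) \<le> 3/2" using norm_triangle_ineq4[of "q w" 1] b(2)[OF w] by simp
    qed (use that in auto)
    then show ?thesis using that by simp
  qed
  show thesis
  proof (rule that[of "\<lambda>z. a z + of_real \<eta> * z" "\<lambda>z. a' z + of_real \<eta>" q q' "\<lambda>z. e z + of_real \<eta> * (g z - g 0)" r1 r2 B])
    fix z :: complex assume z: "cmod z < 1"
    show "((\<lambda>z. a z + of_real \<eta> * z) has_field_derivative a' z + of_real \<eta>) (at z)"
      by (auto intro!: derivative_eq_intros a[OF z])
    show "(q has_field_derivative q' z) (at z)" by (rule q[OF z])
    show "((\<lambda>z. e z + of_real \<eta> * (g z - g 0)) has_field_derivative (q z - 1) * (a' z + of_real \<eta>)) (at z)"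
      by (auto intro!: derivative_eq_intros e[OF z] g[OF z] simp: algebra_simps)
    show "cmod (q z) \<le> 1/2" by (rule b(2)[OF z])
    have "\<bar>\<eta> * Im z\<bar> \<le> 1/2 * 1"
      unfolding abs_mult using \<eta> z abs_Im_le_cmod[of z] by (intro mult_mono) auto
    then show "\<bar>Im (a z + of_real \<eta> * z)\<bar> \<le> 1" using b(1)[OF z] by simp
    have "\<bar>\<eta> * Re (g z - g 0)\<bar> \<le> 1/2 * (3/2)"
      unfolding abs_mult using \<eta> g_bound[OF z] abs_Re_le_cmod[of "g z - g 0"] by (intro mult_mono) linarith+
    then show "\<bar>Re (e z + of_real \<eta> * (g z - g 0))\<bar> \<le> 2" using b(3)[OF z] by simp
    show "0 < cmod (a' z + of_real \<eta>) + cmod (q' z)"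
    proof (cases "q' z = 0")
      case True
      then have "Re (a' z + of_real \<eta>) \<noteq> 0" using \<eta>0[OF z True] by simp
      then have "a' z + of_real \<eta> \<noteq> 0" by (metis zero_complex.sel(1))
      then show ?thesis by (simp add: add_pos_nonneg)
    qed (simp add: add_nonneg_pos)
  next
    fix k z assume "r1 k \<le> cmod z" "cmod z \<le> r2 k"
    then show "B k \<le> cmod (a' z + of_real \<eta>) + cmod (q' z)"
      using B(3)[of k z] norm_diff_ineq[of "a' z" "of_real \<eta>"] \<eta> by simp
  qed (use r B in auto)
qed

section \<open>The flat front\<close>

text \<open>The tube curve gives a front whose Gauss maps are bounded; a similarity of the plane,
  realised by a constant left factor in SL(2,C), moves their images into the prescribed ball while
  keeping the metric.\<close>

lemma weakly_complete_front_in_ball: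
  fixes c :: complex and r :: real
  assumes r: "r > 0"
  shows "\<exists>A B C D. holomorphic_legendrian_immersion A B C D \<and> weakly_complete A B C D \<and>
           gauss_plus A C ` unit_disk \<subseteq> Some ` ball c r \<and> gauss_minus B D ` unit_disk \<subseteq> Some ` ball c r"
proof -
  obtain \<alpha> \<alpha>' q q' \<delta> r1 r2 M where
    \<alpha>: "\<And>z. cmod z < 1 \<Longrightarrow> (\<alpha> has_field_derivative \<alpha>' z) (at z)"
    and q: "\<And>z. cmod z < 1 \<Longrightarrow> (q has_field_derivative q' z) (at z)"
    and \<delta>: "\<And>z. cmod z < 1 \<Longrightarrow> (\<delta> has_field_derivative (q z - 1) * \<alpha>' z) (at z)"
    and b: "\<And>z. cmod z < 1 \<Longrightarrow> \<bar>Im (\<alpha> z)\<bar> \<le> 1" "\<And>z. cmod z < 1 \<Longrightarrow> cmod (q z) \<le> 1/2"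
    "\<And>z. cmod z < 1 \<Longrightarrow> \<bar>Re (\<delta> z)\<bar> \<le> 2" and pos: "\<And>z. cmod z < 1 \<Longrightarrow> 0 < cmod (\<alpha>' z) + cmod (q' z)"
    and ann: "\<And>k. r1 k < r2 k" "\<And>k. r2 k < r1 (Suc k)" "\<And>k. r2 k < 1" "r1 \<longlonglongrightarrow> 1"
    and M: "\<And>k. 0 < M k" "\<And>k. 1 / (32768 * (real k + 1)) \<le> M k * (r2 k - r1 k)"
    "\<And>k z. r1 k \<le> cmod z \<Longrightarrow> cmod z \<le> r2 k \<Longrightarrow> M k \<le> cmod (\<alpha>' z) + cmod (q' z)"
  proof (rule immersed_tube_curve, goal_cases)
    case 1
    show ?case by (rule that) (fact 1)+
  qed
  \<comment> \<open>The Gauss maps of the unscaled lift are bounded by \<open>5 * exp 1\<close>;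
    scaling by \<open>s * s = r / (6 * exp 1)\<close> makes this less than \<open>r\<close>, and
    \<open>s * t = c\<close> recentres it.\<close>
  define s :: complex where "s = of_real (sqrt (r / (6 * exp 1)))"
  define t where "t = c / s"
  have s0: "s \<noteq> 0" using r by (simp add: s_def)
  have s2: "s * s = of_real (r / (6 * exp 1))"
    using r unfolding s_def by (simp flip: of_real_mult)
  \<comment> \<open>The lift with Gauss maps \<open>G = exp (\<i> \<alpha>)\<close> and \<open>H = G (q - 1 - \<i>) / (q - 1)\<close>: its columns are
    \<open>(G, 1) / \<Delta>\<close> and \<open>(H, 1) \<Delta> / (G - H)\<close> with \<open>\<Delta> = exp \<delta>\<close>, and it is Legendrian because
    \<open>d\<Delta> / \<Delta> = dG / (G - H)\<close>. Left multiplication by the matrix \<open>(s, t; 0, 1/s)\<close> acts on both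
    Gauss maps by \<open>w \<mapsto> s\<^sup>2 w + s t\<close> and does not change \<open>\<omega>\<close> and \<open>\<theta>\<close>.\<close>
  define A0 where "A0 z = exp (\<i> * \<alpha> z - \<delta> z)" for z
  define B0 where "B0 z = - \<i> * (q z - 1 - \<i>) * exp (\<delta> z)" for z
  define C0 where "C0 z = exp (- \<delta> z)" for z
  define D0 where "D0 z = - \<i> * (q z - 1) * exp (\<delta> z - \<i> * \<alpha> z)" for z
  define A where "A z = s * A0 z + t * C0 z" for z
  define B where "B z = s * B0 z + t * D0 z" for z
  define C where "C z = C0 z / s" for z
  define D where "D z = D0 z / s" for z
  define dA where "dA z = (\<i> * \<alpha>' z - (q z - 1) * \<alpha>' z) * A0 z" for z
  define dB where "dB z = - \<i> * (q' z + (q z - 1 - \<i>) * ((q z - 1) * \<alpha>' z)) * exp (\<delta> z)" for z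
  define dC where "dC z = - ((q z - 1) * \<alpha>' z) * C0 z" for z
  define dD where "dD z = - \<i> * (q' z + (q z - 1) * ((q z - 1) * \<alpha>' z - \<i> * \<alpha>' z)) * exp (\<delta> z - \<i> * \<alpha> z)" for z
  have dA: "(A has_field_derivative s * dA z + t * dC z) (at z)"
    and dB: "(B has_field_derivative s * dB z + t * dD z) (at z)"
    and dC: "(C has_field_derivative dC z / s) (at z)"
    and dD: "(D has_field_derivative dD z / s) (at z)" if z: "cmod z < 1" for z
  proof -
    note d [derivative_intros] = \<alpha>[OF z] q[OF z] \<delta>[OF z]
    have "(A0 has_field_derivative dA z) (at z)" unfolding A0_def dA_def
      by (auto intro!: derivative_eq_intros simp: algebra_simps)
    moreover have "(B0 has_field_derivative dB z) (at z)" unfolding B0_def dB_def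
      by (auto intro!: derivative_eq_intros simp: algebra_simps)
    moreover have "(C0 has_field_derivative dC z) (at z)" unfolding C0_def dC_def
      by (auto intro!: derivative_eq_intros simp: algebra_simps)
    moreover have "(D0 has_field_derivative dD z) (at z)" unfolding D0_def dD_def
      by (auto intro!: derivative_eq_intros simp: algebra_simps)
    ultimately show "(A has_field_derivative s * dA z + t * dC z) (at z)"
      "(B has_field_derivative s * dB z + t * dD z) (at z)"
      "(C has_field_derivative dC z / s) (at z)" "(D has_field_derivative dD z / s) (at z)"
      unfolding A_def B_def C_def D_def using s0
      by (auto intro!: derivative_eq_intros)
  qed
  have deriv: "deriv A z = s * dA z + t * dC z" "deriv B z = s * dB z + t * dD z"
     "deriv C z = dC z / s" "deriv D z = dD z / s" if "cmod z < 1" for z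
    using dA dB dC dD that by (auto intro: DERIV_imp_deriv)
  have AC: "A0 z = exp (\<i> * \<alpha> z) * C0 z" for z unfolding A0_def C0_def by (simp flip: exp_add)
  have ee: "exp (\<i> * \<alpha> z - \<delta> z) * exp (\<delta> z - \<i> * \<alpha> z) = 1" "exp (- \<delta> z) * exp (\<delta> z) = 1" for z
    by (simp_all flip: exp_add)
  have det: "A z * D z - B z * C z = 1" for z
  proof -
    have "A z * D z - B z * C z = A0 z * D0 z - B0 z * C0 z"
      using s0 by (simp add: A_def B_def C_def D_def field_simps)
    also have "\<dots> = - \<i> * (q z - 1) * (exp (\<i> * \<alpha> z - \<delta> z) * exp (\<delta> z - \<i> * \<alpha> z))
        + \<i> * (q z - 1 - \<i>) * (exp (- \<delta> z) * exp (\<delta> z))"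
      unfolding A0_def B0_def C0_def D0_def by (simp add: algebra_simps)
    also have "\<dots> = 1" unfolding ee by (simp add: algebra_simps)
    finally show ?thesis .
  qed
  have legendrian: "A z * deriv D z - C z * deriv B z = 0" if "cmod z < 1" for z
  proof -
    have "A z * deriv D z - C z * deriv B z = A0 z * dD z - C0 z * dB z"
      unfolding deriv[OF that] using s0 by (simp add: A_def C_def field_simps)
    also have "\<dots> = - \<i> * (q' z + (q z - 1) * ((q z - 1) * \<alpha>' z - \<i> * \<alpha>' z)) * (exp (\<i> * \<alpha> z - \<delta> z) * exp (\<delta> z - \<i> * \<alpha> z))
        + \<i> * (q' z + (q z - 1 - \<i>) * ((q z - 1) * \<alpha>' z)) * (exp (- \<delta> z) * exp (\<delta> z))"
      unfolding A0_def C0_def dD_def dB_def by (simp add: algebra_simps)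
    also have "\<dots> = 0" unfolding ee by (simp add: algebra_simps)
    finally show ?thesis .
  qed
  define W where "W z = exp (\<i> * \<alpha> z - 2 * \<delta> z)" for z
  define V where "V z = exp (2 * \<delta> z - \<i> * \<alpha> z)" for z
  have "W z = exp (\<i> * \<alpha> z - \<delta> z) * exp (- \<delta> z)" "V z = exp (\<delta> z) * exp (\<delta> z - \<i> * \<alpha> z)" for z
    unfolding W_def V_def by (simp_all add: algebra_simps flip: exp_add)
  note WV = this
  have omega: "omega_coef A C z = - \<i> * \<alpha>' z * W z" if "cmod z < 1" for z
  proof -
    have "omega_coef A C z = A0 z * dC z - C0 z * dA z"
      unfolding omega_coef_def deriv[OF that] using s0 by (simp add: A_def C_def field_simps)
    also have "\<dots> = - \<i> * \<alpha>' z * (A0 z * C0 z)" unfolding dA_def dC_def by (simp add: algebra_simps)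
    finally show ?thesis unfolding WV A0_def C0_def .
  qed
  define K where "K z = (q z - 1) * (q z - 1 - \<i>)" for z
  have theta: "theta_coef B D z = - \<i> * (q' z + K z * \<alpha>' z) * V z" if "cmod z < 1" for z
  proof -
    have "theta_coef B D z = D0 z * dB z - B0 z * dD z"
      unfolding theta_coef_def deriv[OF that] using s0 by (simp add: B_def D_def field_simps)
    also have "\<dots> = - ((q z - 1) * (q' z + (q z - 1 - \<i>) * ((q z - 1) * \<alpha>' z))
        - (q z - 1 - \<i>) * (q' z + (q z - 1) * ((q z - 1) * \<alpha>' z - \<i> * \<alpha>' z))) * V z"
      unfolding B0_def D0_def dB_def dD_def WV
      by (simp add: algebra_simps)
    also have "\<dots> = - \<i> * (q' z + K z * \<alpha>' z) * V z" unfolding K_def by (simp add: algebra_simps)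
    finally show ?thesis .
  qed
  define \<rho> where "\<rho> z = (cmod (omega_coef A C z))\<^sup>2 + (cmod (theta_coef B D z))\<^sup>2" for z
  have q1: "1/2 \<le> cmod (q z - 1)" "cmod (q z - 1) \<le> 3/2" "cmod (q z - 1 - \<i>) \<le> 5/2" if "cmod z < 1" for z
    using b(2)[OF that] norm_triangle_ineq4[of "q z" 1] norm_triangle_ineq2[of 1 "q z"]
      norm_triangle_ineq4[of "q z - 1" \<i>] by (auto simp: norm_minus_commute)
  \<comment> \<open>\<open>W\<close> and \<open>V\<close> have modulus at least
    \<open>exp (-5)\<close>, because \<open>\<bar>Im \<alpha>\<bar> + 2 * \<bar>Re \<delta>\<bar>
    \<le> 5\<close>. So \<open>\<omega>\<close> controls \<open>\<alpha>'\<close>, and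
    \<open>\<theta>\<close> then controls \<open>q'\<close> up to \<open>K * \<alpha>'\<close> with
    \<open>cmod (K z) \<le> 15/4\<close>; the factor 6 is 1 + 1 + 4.\<close>
  have lower: "cmod (\<alpha>' z) + cmod (q' z) \<le> 6 * exp 5 * sqrt (\<rho> z)" if z: "cmod z < 1" for z
  proof -
    have "exp (-5) \<le> cmod (W z)" "exp (-5) \<le> cmod (V z)"
      using b(1,3)[OF z] unfolding W_def V_def by (auto simp: abs_le_iff)
    then have "1 \<le> exp 5 * cmod (W z)" "1 \<le> exp 5 * cmod (V z)"
      by (auto simp: exp_minus field_simps)
    then have 1: "cmod (\<alpha>' z) * 1 \<le> cmod (\<alpha>' z) * (exp 5 * cmod (W z))"
      "cmod (q' z + K z * \<alpha>' z) * 1 \<le> cmod (q' z + K z * \<alpha>' z) * (exp 5 * cmod (V z))"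
      by (intro mult_left_mono; simp)+
    have "cmod (\<alpha>' z) * (exp 5 * cmod (W z)) = exp 5 * cmod (omega_coef A C z)"
      "cmod (q' z + K z * \<alpha>' z) * (exp 5 * cmod (V z)) = exp 5 * cmod (theta_coef B D z)"
      unfolding omega[OF z] theta[OF z] by (simp_all add: norm_mult)
    moreover have "exp 5 * cmod (omega_coef A C z) \<le> exp 5 * sqrt (\<rho> z)"
      "exp 5 * cmod (theta_coef B D z) \<le> exp 5 * sqrt (\<rho> z)"
      unfolding \<rho>_def by (auto intro: real_le_rsqrt)
    ultimately have 2: "cmod (\<alpha>' z) \<le> exp 5 * sqrt (\<rho> z)" "cmod (q' z + K z * \<alpha>' z) \<le> exp 5 * sqrt (\<rho> z)"
      using 1 by linarith+
    have "cmod (K z) \<le> 3/2 * (5/2)" unfolding K_def norm_mult using q1[OF z] by (intro mult_mono) auto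
    then have "cmod (K z * \<alpha>' z) \<le> 4 * cmod (\<alpha>' z)" unfolding norm_mult by (intro mult_right_mono) auto
    then have "cmod (q' z) \<le> cmod (q' z + K z * \<alpha>' z) + 4 * cmod (\<alpha>' z)"
      using norm_diff_ineq[of "q' z" "K z * \<alpha>' z"] by simp
    then show ?thesis using 2 by simp
  qed
  have rho_pos: "\<rho> z > 0" if z: "cmod z < 1" for z
  proof -
    have "0 < 6 * exp 5 * sqrt (\<rho> z)" using lower[OF z] pos[OF z] by linarith
    then show ?thesis by (simp add: zero_less_mult_iff)
  qed
  have "holomorphic_legendrian_immersion A B C D"
    unfolding holomorphic_legendrian_immersion_def
  proof (intro conjI ballI)
    show "A holomorphic_on unit_disk" "B holomorphic_on unit_disk" "C holomorphic_on unit_disk" "D holomorphic_on unit_disk"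
      unfolding unit_disk_def by (rule holomorphic_on_unit_ballI[OF dA] holomorphic_on_unit_ballI[OF dB]
        holomorphic_on_unit_ballI[OF dC] holomorphic_on_unit_ballI[OF dD]; assumption)+
    fix z assume "z \<in> unit_disk"
    then have z: "cmod z < 1" by (simp add: unit_disk_def)
    show "A z * D z - B z * C z = 1" by (rule det)
    show "A z * deriv D z - C z * deriv B z = 0" by (rule legendrian[OF z])
    \<comment> \<open>If all four derivatives vanished, both coefficient forms and hence
      \<open>\<rho>\<close> would vanish at \<open>z\<close>.\<close>
    show "(deriv A z, deriv B z, deriv C z, deriv D z) \<noteq> (0, 0, 0, 0)"
      using rho_pos[OF z] by (auto simp: \<rho>_def omega_coef_def theta_coef_def)
  qed
  moreover have "weakly_complete A B C D"
    unfolding weakly_complete_def complete_conformal_metric_def \<rho>_def[symmetric]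
  proof (intro conjI ballI allI impI)
    show "0 < \<rho> z" if "z \<in> unit_disk" for z using that rho_pos by (simp add: unit_disk_def)
    fix \<gamma> \<gamma>' :: "real \<Rightarrow> complex"
    assume \<gamma>: "(\<forall>t\<in>{0..<1}. \<gamma> t \<in> unit_disk) \<and>
         (\<forall>t\<in>{0..<1}. (\<gamma> has_vector_derivative \<gamma>' t) (at t within {0..<1})) \<and>
         continuous_on {0..<1} \<gamma>' \<and> ((\<lambda>t. norm (\<gamma> t)) \<longlongrightarrow> 1) (at_left (1::real))"
    define k6 :: real where "k6 = 6 * exp 5"
    have k6: "k6 > 0" by (simp add: k6_def)
    show "(\<integral>\<^sup>+ t. ennreal (indicator {0..<1} t * (sqrt (\<rho> (\<gamma> t)) * norm (\<gamma>' t))) \<partial>lborel) = \<infinity>"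
    \<comment> \<open>By \<open>lower\<close>, the density \<open>sqrt (\<rho> z)\<close> is at
      least \<open>M k / k6\<close> on the annulus of index \<open>k\<close>, so the crossing costs
      dominate a multiple of the harmonic series.\<close>
    proof (rule infinite_length_crossing_annuli[where B="\<lambda>k. M k / k6" and c="\<lambda>k. 1 / (32768 * (real k + 1)) / k6", OF ann])
      show "0 \<le> M k / k6" for k using M(1)[of k] k6 by simp
      show "M k / k6 \<le> sqrt (\<rho> z)" if "r1 k \<le> cmod z" "cmod z \<le> r2 k" for k z
        using M(3)[OF that] lower[of z] that ann(3)[of k] k6 by (simp add: k6_def field_simps)
      show "0 \<le> 1 / (32768 * (real k + 1)) / k6" for k using k6 by simp
      show "1 / (32768 * (real k + 1)) / k6 \<le> M k / k6 * (r2 k - r1 k)" for k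
        using divide_right_mono[OF M(2)[of k], of k6] k6 by simp
      have "(\<lambda>k. 1 / (32768 * (real k + 1)) / k6) = (\<lambda>k. 1 / (32768 * k6) * inverse (real (Suc k)))"
        by (rule ext) (simp add: field_simps)
      moreover have "\<not> summable (\<lambda>k. inverse (real (Suc k)))"
        using not_summable_harmonic[where 'a=real] summable_Suc_iff[of "\<lambda>n. inverse (real n)"] by blast
      ultimately show "\<not> summable (\<lambda>k. 1 / (32768 * (real k + 1)) / k6)"
        using k6 by (simp only: summable_cmult_iff) simp
      show "cmod (\<gamma> 0) < 1" using \<gamma> by (force simp: unit_disk_def)
    qed (use \<gamma> in auto)
  qed
  moreover have ex: "cmod (exp (\<i> * \<alpha> z)) \<le> exp 1" if "cmod z < 1" for z using b(1)[OF that] by (simp add: abs_le_iff)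
  have in_ball: "s * s * w + c \<in> ball c r" if "cmod w \<le> 5 * exp 1" for w
  proof -
    have "cmod (s * s * w) = r / (6 * exp 1) * cmod w" unfolding s2 norm_mult norm_of_real using r by simp
    also have "\<dots> \<le> r / (6 * exp 1) * (5 * exp 1)" using r that by (intro mult_left_mono) auto
    also have "\<dots> < r" using r by simp
    finally show ?thesis by (simp add: dist_norm)
  qed
  have st: "s * t = c" using s0 by (simp add: t_def)
  have "gauss_plus A C z \<in> Some ` ball c r" if "z \<in> unit_disk" for z
  proof -
    have z: "cmod z < 1" using that by (simp add: unit_disk_def)
    have C0: "C0 z \<noteq> 0" by (simp add: C0_def)
    then have "A z / C z = s * s * exp (\<i> * \<alpha> z) + s * t" using s0 by (simp add: A_def C_def AC field_simps)
    moreover have "cmod (exp (\<i> * \<alpha> z)) \<le> 5 * exp 1" using ex[OF z] exp_gt_zero[of "1::real"] by linarith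
    ultimately have "A z / C z \<in> ball c r" using in_ball st by simp
    then show ?thesis using C0 s0 by (simp add: gauss_plus_def sphere_quot_def C_def)
  qed
  moreover have "gauss_minus B D z \<in> Some ` ball c r" if "z \<in> unit_disk" for z
  proof -
    have z: "cmod z < 1" using that by (simp add: unit_disk_def)
    have q0: "q z - 1 \<noteq> 0" using q1(1)[OF z] by auto
    then have D0: "D0 z \<noteq> 0" by (simp add: D0_def)
    define w where "w = (q z - 1 - \<i>) / (q z - 1) * exp (\<i> * \<alpha> z)"
    have "exp (\<delta> z) = exp (\<i> * \<alpha> z) * exp (\<delta> z - \<i> * \<alpha> z)" by (simp flip: exp_add)
    then have "B0 z = w * D0 z" using q0 by (simp add: B0_def D0_def w_def)
    then have "B z / D z = s * s * w + s * t" using s0 D0 by (simp add: B_def D_def field_simps)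
    moreover have "cmod w \<le> 5 * exp 1"
    proof -
      have "cmod ((q z - 1 - \<i>) / (q z - 1)) \<le> (5/2) / (1/2)"
        unfolding norm_divide using q1[OF z] by (intro frac_le) auto
      then have "cmod w \<le> (5/2) / (1/2) * exp 1"
        unfolding w_def norm_mult using ex[OF z] by (intro mult_mono) auto
      then show ?thesis by simp
    qed
    ultimately have "B z / D z \<in> ball c r" using in_ball st by simp
    then show ?thesis using D0 s0 by (simp add: gauss_minus_def sphere_quot_def D_def)
  qed
  ultimately show ?thesis by (intro exI[of _ A] exI[of _ B] exI[of _ C] exI[of _ D]) blast
qed

section \<open>Reduction of arbitrary disks of the sphere to round balls\<close>

lemma open_sphere_disk_contains_ball:
  assumes "open_sphere_disk S"
  obtains c r where "r > 0" "Some ` ball c r \<subseteq> S"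
proof -
  consider (ball) c r where "r > 0" "S = Some ` ball c r"
    | (exterior) c r where "r > 0" "S = insert None (Some ` {z. dist z c > r})"
    | (halfplane) u a where "u \<noteq> 0" "S = Some ` {z. Re (cnj u * z) > a}"
    using assms unfolding open_sphere_disk_def by blast
  then show thesis
  proof cases
    case ball
    then show ?thesis using that by blast
  next
    case (exterior c r)
    have "dist z c > r" if "z \<in> ball (c + of_real (2 * r)) r" for z
    proof -
      have "dist (c + of_real (2 * r)) c = 2 * r" using exterior(1) by (simp add: dist_norm)
      then show ?thesis using that dist_triangle[of "c + of_real (2 * r)" c z] by (simp add: dist_commute)
    qed
    then show ?thesis using that[of r "c + of_real (2 * r)"] exterior by blast
  next
    case (halfplane u a)
    \<comment> \<open>At this centre \<open>Re (cnj u * z)\<close> equals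
      \<open>\<bar>a\<bar> + cmod u + 1\<close>, and within the unit ball around it the value
      changes by at most \<open>cmod u\<close>.\<close>
    define c where "c = of_real (\<bar>a\<bar> + cmod u + 1) / cnj u"
    have "Re (cnj u * z) > a" if "z \<in> ball c 1" for z
    proof -
      have "cmod (cnj u * (z - c)) \<le> cmod u * 1"
        unfolding norm_mult using that by (intro mult_mono) (auto simp: dist_norm norm_minus_commute)
      then have "\<bar>Re (cnj u * (z - c))\<bar> \<le> cmod u" using abs_Re_le_cmod[of "cnj u * (z - c)"] by linarith
      moreover have "cnj u * c = of_real (\<bar>a\<bar> + cmod u + 1)" using halfplane(1) by (simp add: c_def)
      then have "Re (cnj u * c) = \<bar>a\<bar> + cmod u + 1" by simp
      ultimately show ?thesis by (simp add: right_diff_distrib)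
    qed
    then show ?thesis using that[of 1 c] halfplane(2) zero_less_one by blast
  qed
qed

theorem mainTheorem1:
  fixes \<D> :: "csphere set"
  assumes "open_sphere_disk \<D>"
  shows "\<exists>A B C D. holomorphic_legendrian_immersion A B C D \<and> weakly_complete A B C D \<and>
           gauss_plus A C ` unit_disk \<subseteq> \<D> \<and> gauss_minus B D ` unit_disk \<subseteq> \<D>"
proof -
  obtain c r where "r > 0" "Some ` ball c r \<subseteq> \<D>"
    using open_sphere_disk_contains_ball[OF assms] .
  then show ?thesis using weakly_complete_front_in_ball[of r c] by (meson order_trans)
qed

end
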